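(* Let $R$ be an algebra over a commutative ring $\mathbb K$ and let $\mathcal B=(B,\xi,\zeta,\Delta,\epsilon)$ be a right bialgebroid over $R$. Let $T$ be a right $\mathcal B$-comodule algebra with coaction $t\mapsto t^{[0]}\otimes_Rt^{[1]}$, and let $X$ be a right $\mathcal B$-module with action $\triangleleft$. Regard $T$ as an $R$-ring via the algebra map $\varphi:R\to T$, $r\mapsto r\cdot1_T=1_T\cdot r$. Then $$w:X\otimes_RT\to T\otimes_RX,\qquad x\otimes_Rt\mapsto t^{[0]}\otimes_Rx\triangleleft t^{[1]}$$ is a transposition map for $\varphi$. Hence the cosimplicial $\mathbb K$-module $T^{\widehat\otimes_R\,\ast+1}\widehat\otimes_RX$ admits a para-cocyclic structure $$w_n(t_0\widehat\otimes_R\dots\widehat\otimes_Rt_n\widehat\otimes_Rx)=t_1\widehat\otimes_R\dots\widehat\otimes_Rt_n\widehat\otimes_Rt_0^{[0]}\widehat\otimes_R(x\triangleleft t_0^{[1]}).$$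
   Context: All algebras are associative and unital; implicit summation is used in index notations. Right bialgebroid over $R$: data $(B,\xi,\zeta,\Delta,\epsilon)$ with $B$ a $\mathbb K$-algebra, $\xi:R\to B$ and $\zeta:R^{op}\to B$ algebra maps with commuting ranges; $B$ is an $R$-bimodule by $r_1\cdot b\cdot r_2=b\,\zeta(r_1)\xi(r_2)$; $\Delta:B\to B\otimes_RB$, $b\mapsto b^{(1)}\otimes_Rb^{(2)}$, and $\epsilon:B\to R$ make this bimodule an $R$-coring (a coalgebra in the monoidal category of $R$-bimodules); and (i) $\xi(r)b^{(1)}\otimes_Rb^{(2)}=b^{(1)}\otimes_R\zeta(r)b^{(2)}$; (ii) $\Delta(1_B)=1_B\otimes_R1_B$, $\Delta(bb')=b^{(1)}b'^{(1)}\otimes_Rb^{(2)}b'^{(2)}$; (iii) $\epsilon(1_B)=1_R$, $\epsilon(bb')=\epsilon(\xi(\epsilon(b))b')$. A right $\mathcal B$-module $V$ is an $R$-bimodule by $r_1\cdot v\cdot r_2=v\triangleleft(\zeta(r_1)\xi(r_2))$. A right $\mathcal B$-comodule is a right $R$-module $V$ with a right $R$-linear, coassociative and counital coaction $V\to V\otimes_R\mathcal B$, $v\mapsto v^{[0]}\otimes_Rv^{[1]}$; it is an $R$-bimodule with left action $r\cdot v:=v^{[0]}\cdot\epsilon(\xi(r)v^{[1]})$. A right $\mathcal B$-comodule algebra is a $\mathbb K$-algebra and right $\mathcal B$-comodule $T$ whose multiplication is $R$-balanced and such that $1_T^{[0]}\otimes_R1_T^{[1]}=1_T\otimes_R1_B$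 and $(tt')^{[0]}\otimes_R(tt')^{[1]}=t^{[0]}t'^{[0]}\otimes_Rt^{[1]}t'^{[1]}$. Transposition map: for an algebra map $\varphi:R\to T$ with multiplication $m_T:T\otimes_RT\to T$ and an $R$-bimodule $X$, it is an $R$-bimodule map $w:X\otimes_RT\to T\otimes_RX$ with $w\circ(X\otimes_R\varphi)=\varphi\otimes_RX$ (identifying $X\otimes_RR\cong X\cong R\otimes_RX$) and $w\circ(X\otimes_Rm_T)=(m_T\otimes_RX)\circ(T\otimes_Rw)\circ(w\otimes_RT)$. Cyclic tensor product: for $R$-bimodules, $X_1\widehat\otimes_R\dots\widehat\otimes_RX_n$ is the quotient $\mathbb K$-module of $Y=X_1\otimes_R\dots\otimes_RX_n$ by the submodule generated by $r\cdot y-y\cdot r$, $r\in R$, $y\in Y$; the class of $x_1\otimes_R\dots\otimes_R x_n$ is $x_1\widehat\otimes_R\dots\widehat\otimes_Rx_n$. The cosimplicial $\mathbb K$-module $Z^n=T^{\widehat\otimes_R\,n+1}\widehat\otimes_RX$ has cofaces $d_k:Z^{n-1}\to Z^n$ and codegeneracies $s_k:Z^{n+1}\to Z^n$ ($0\le k\le n$): $d_k$ inserts $1_T$ between $t_{k-1}$ and $t_k$ (for $k=0$ in front of $t_0$, for $k=n$ between $t_{n-1}$ and $x$), and $s_k$ replaces $t_k\widehat\otimes_Rt_{k+1}$ by the product $t_kt_{k+1}$. A para-cocyclic structure on a cosimplicial object consists of morphisms $w_n:Z^n\to Z^n$ with $w_nd_0=d_n$, $w_nd_k=d_{k-1}w_{n-1}$,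 $w_ns_0=s_n(w_{n+1})^2$, $w_ns_k=s_{k-1}w_{n+1}$ for $1\le k\le n$ (relations with cofaces for $n\ge1$). *)

theory Defs
  imports
    "HOL-Library.Poly_Mapping"
    "HOL-Library.Set_Algebras"
    "HOL-Computational_Algebra.Group_Closure"
begin

text \<open>
  Unital rings have sort \<open>{ring, monoid_mult}\<close> and the commutative ground ring has sort
  \<open>{comm_ring, comm_monoid_mult}\<close> rather than \<open>ring_1\<close> and \<open>comm_ring_1\<close>, because the latter
  classes exclude the zero ring. Algebras and modules live on types; tensor products depend on
  the actions, hence are sets of cosets of a subgroup in a free abelian group
  \<open>'g \<Rightarrow>\<^sub>0 int\<close>. The coset of \<open>f\<close> is \<open>f +o N\<close>, and cosets are added by the elementwise sum of
  sets.
\<close>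

section \<open>Modules and algebras over a commutative ring\<close>

text \<open>
  The zero is a parameter since for cosets of \<open>N\<close> it is \<open>N\<close>, while the \<open>0\<close> of the type class is
  \<open>{0}\<close>.
\<close>

locale k_module_on =
  fixes M :: "'v::ab_semigroup_add set" and zero :: 'v
    and scl :: "'k::{comm_ring,comm_monoid_mult} \<Rightarrow> 'v \<Rightarrow> 'v"
  assumes zero_closed: "zero \<in> M"
    and add_closed: "x \<in> M \<Longrightarrow> y \<in> M \<Longrightarrow> x + y \<in> M"
    and scl_closed: "x \<in> M \<Longrightarrow> scl c x \<in> M"
    and zero_add: "x \<in> M \<Longrightarrow> zero + x = x"
    and add_inverse: "x \<in> M \<Longrightarrow> \<exists>y\<in>M. x + y = zero"
    and scl_add_right: "x \<in> M \<Longrightarrow> y \<in> M \<Longrightarrow> scl c (x + y) = scl c x + scl c y"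
    and scl_add_left: "x \<in> M \<Longrightarrow> scl (c + c') x = scl c x + scl c' x"
    and scl_scl: "x \<in> M \<Longrightarrow> scl c (scl c' x) = scl (c * c') x"
    and scl_one: "x \<in> M \<Longrightarrow> scl 1 x = x"

locale k_module = k_module_on UNIV 0 scl
  for scl :: "'k::{comm_ring,comm_monoid_mult} \<Rightarrow> 'v::ab_group_add \<Rightarrow> 'v"

locale k_algebra = k_module scl
  for scl :: "'k::{comm_ring,comm_monoid_mult} \<Rightarrow> 'a::{ring,monoid_mult} \<Rightarrow> 'a" +
  assumes scl_mult_left: "scl c a * b = scl c (a * b)"
    and scl_mult_right: "a * scl c b = scl c (a * b)"

definition k_linear ::
  "'m::plus set \<Rightarrow> ('k \<Rightarrow> 'm \<Rightarrow> 'm) \<Rightarrow> 'n::plus set \<Rightarrow> ('k \<Rightarrow> 'n \<Rightarrow> 'n) \<Rightarrow> ('m \<Rightarrow> 'n) \<Rightarrow> bool"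
  where "k_linear M sM N sN h \<longleftrightarrow>
    (\<forall>x\<in>M. h x \<in> N) \<and> (\<forall>x\<in>M. \<forall>y\<in>M. h (x + y) = h x + h y) \<and>
    (\<forall>c. \<forall>x\<in>M. h (sM c x) = sN c (h x))"

definition k_algebra_hom ::
  "('k \<Rightarrow> 'a \<Rightarrow> 'a) \<Rightarrow> ('k \<Rightarrow> 'b \<Rightarrow> 'b) \<Rightarrow> ('a::{ring,monoid_mult} \<Rightarrow> 'b::{ring,monoid_mult}) \<Rightarrow> bool"
  where "k_algebra_hom sA sB h \<longleftrightarrow>
    k_linear UNIV sA UNIV sB h \<and> h 1 = 1 \<and> (\<forall>x y. h (x * y) = h x * h y)"

text \<open>An algebra map out of the opposite algebra:\<close>

definition k_algebra_antihom ::
  "('k \<Rightarrow> 'a \<Rightarrow> 'a) \<Rightarrow> ('k \<Rightarrow> 'b \<Rightarrow> 'b) \<Rightarrow> ('a::{ring,monoid_mult} \<Rightarrow> 'b::{ring,monoid_mult}) \<Rightarrow> bool"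
  where "k_algebra_antihom sA sB h \<longleftrightarrow>
    k_linear UNIV sA UNIV sB h \<and> h 1 = 1 \<and> (\<forall>x y. h (x * y) = h y * h x)"

locale right_module = A: k_algebra sA + V: k_module sV
  for sA :: "'k::{comm_ring,comm_monoid_mult} \<Rightarrow> 'a::{ring,monoid_mult} \<Rightarrow> 'a"
    and sV :: "'k \<Rightarrow> 'v::ab_group_add \<Rightarrow> 'v" +
  fixes act :: "'v \<Rightarrow> 'a \<Rightarrow> 'v"
  assumes act_add_left: "act (v + v') a = act v a + act v' a"
    and act_add_right: "act v (a + a') = act v a + act v a'"
    and act_scl_left: "act (sV c v) a = sV c (act v a)"
    and act_scl_right: "act v (sA c a) = sV c (act v a)"
    and act_one: "act v 1 = v"
    and act_mult: "act v (a * a') = act (act v a) a'"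

locale left_module = A: k_algebra sA + V: k_module sV
  for sA :: "'k::{comm_ring,comm_monoid_mult} \<Rightarrow> 'a::{ring,monoid_mult} \<Rightarrow> 'a"
    and sV :: "'k \<Rightarrow> 'v::ab_group_add \<Rightarrow> 'v" +
  fixes act :: "'a \<Rightarrow> 'v \<Rightarrow> 'v"
  assumes act_add_left: "act (a + a') v = act a v + act a' v"
    and act_add_right: "act a (v + v') = act a v + act a v'"
    and act_scl_left: "act (sA c a) v = sV c (act a v)"
    and act_scl_right: "act a (sV c v) = sV c (act a v)"
    and act_one: "act 1 v = v"
    and act_mult: "act (a * a') v = act a (act a' v)"

locale bimodule = L: left_module sA sV la + R: right_module sA sV ra
  for sA :: "'k::{comm_ring,comm_monoid_mult} \<Rightarrow> 'a::{ring,monoid_mult} \<Rightarrow> 'a"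
    and sV :: "'k \<Rightarrow> 'v::ab_group_add \<Rightarrow> 'v"
    and la :: "'a \<Rightarrow> 'v \<Rightarrow> 'v" and ra :: "'v \<Rightarrow> 'a \<Rightarrow> 'v" +
  assumes act_commute: "ra (la a v) a' = la a (ra v a')"

definition bimodule_map ::
  "'m::plus set \<Rightarrow> ('k \<Rightarrow> 'm \<Rightarrow> 'm) \<Rightarrow> ('a \<Rightarrow> 'm \<Rightarrow> 'm) \<Rightarrow> ('m \<Rightarrow> 'a \<Rightarrow> 'm) \<Rightarrow>
   'n::plus set \<Rightarrow> ('k \<Rightarrow> 'n \<Rightarrow> 'n) \<Rightarrow> ('a \<Rightarrow> 'n \<Rightarrow> 'n) \<Rightarrow> ('n \<Rightarrow> 'a \<Rightarrow> 'n) \<Rightarrow> ('m \<Rightarrow> 'n) \<Rightarrow> bool"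
  where "bimodule_map M sM lM rM N sN lN rN h \<longleftrightarrow>
    k_linear M sM N sN h \<and>
    (\<forall>a. \<forall>x\<in>M. h (lM a x) = lN a (h x)) \<and> (\<forall>a. \<forall>x\<in>M. h (rM x a) = rN (h x) a)"


section \<open>Maps out of quotients of free abelian groups\<close>

definition frag_eval :: "('g \<Rightarrow> 'v::ab_group_add) \<Rightarrow> ('g \<Rightarrow>\<^sub>0 int) \<Rightarrow> 'v" where
  "frag_eval h f = (\<Sum>g\<in>Poly_Mapping.keys f.
     (\<Sum>i<nat (Poly_Mapping.lookup f g). h g) - (\<Sum>i<nat (- Poly_Mapping.lookup f g). h g))"

text \<open>
  The next two operations are additive extensions, evaluated on a coset \<open>C\<close>, of a map \<open>h\<close> between
  generators, resp. of a map \<open>D\<close> sending generators to cosets of \<open>N\<close>. The value is the union of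
  the results for all representatives of \<open>C\<close>; so it is a single coset of \<open>N\<close> exactly if the result
  does not depend on the representative.
\<close>

definition quot_map :: "('h \<Rightarrow>\<^sub>0 int) set \<Rightarrow> ('g \<Rightarrow> 'h) \<Rightarrow> ('g \<Rightarrow>\<^sub>0 int) set \<Rightarrow> ('h \<Rightarrow>\<^sub>0 int) set" where
  "quot_map N h C = (\<Union>f\<in>C. frag_extend (\<lambda>g. frag_of (h g)) f +o N)"

definition quot_extend ::
  "('h \<Rightarrow>\<^sub>0 int) set \<Rightarrow> ('g \<Rightarrow> ('h \<Rightarrow>\<^sub>0 int) set) \<Rightarrow> ('g \<Rightarrow>\<^sub>0 int) set \<Rightarrow> ('h \<Rightarrow>\<^sub>0 int) set" where
  "quot_extend N D C = (\<Union>f\<in>C. frag_extend (\<lambda>g. SOME u. u \<in> D g) f +o N)"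

definition componentwise_mult ::
  "('a::times \<times> 'b::times \<Rightarrow>\<^sub>0 int) \<Rightarrow> ('a \<times> 'b \<Rightarrow>\<^sub>0 int) \<Rightarrow> ('a \<times> 'b \<Rightarrow>\<^sub>0 int)" where
  "componentwise_mult f g =
     frag_extend (\<lambda>(a, b). frag_extend (\<lambda>(a', b'). frag_of (a * a', b * b')) g) f"


section \<open>Tensor products over a noncommutative ring\<close>

text \<open>
  Here \<open>rM\<close>, \<open>rP\<close> are right actions and \<open>lP\<close>, \<open>lQ\<close> are left actions of the ring.
\<close>

definition tensor2_rel ::
  "('m::plus \<Rightarrow> 'r \<Rightarrow> 'm) \<Rightarrow> ('r \<Rightarrow> 'p::plus \<Rightarrow> 'p) \<Rightarrow> ('m \<times> 'p \<Rightarrow>\<^sub>0 int) set" where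
  "tensor2_rel rM lP = group_closure (
     {frag_of (m + m', p) - frag_of (m, p) - frag_of (m', p) |m m' p. True} \<union>
     {frag_of (m, p + p') - frag_of (m, p) - frag_of (m, p') |m p p'. True} \<union>
     {frag_of (rM m r, p) - frag_of (m, lP r p) |m r p. True})"

definition tensor2 ::
  "('m::plus \<Rightarrow> 'r \<Rightarrow> 'm) \<Rightarrow> ('r \<Rightarrow> 'p::plus \<Rightarrow> 'p) \<Rightarrow> ('m \<times> 'p \<Rightarrow>\<^sub>0 int) set set" where
  "tensor2 rM lP = range (\<lambda>f. f +o tensor2_rel rM lP)"

definition tensor3_rel ::
  "('m::plus \<Rightarrow> 'r \<Rightarrow> 'm) \<Rightarrow> ('r \<Rightarrow> 'p::plus \<Rightarrow> 'p) \<Rightarrow> ('p \<Rightarrow> 'r \<Rightarrow> 'p) \<Rightarrow> ('r \<Rightarrow> 'q::plus \<Rightarrow> 'q) \<Rightarrow>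
   ('m \<times> 'p \<times> 'q \<Rightarrow>\<^sub>0 int) set" where
  "tensor3_rel rM lP rP lQ = group_closure (
     {frag_of (m + m', p, q) - frag_of (m, p, q) - frag_of (m', p, q) |m m' p q. True} \<union>
     {frag_of (m, p + p', q) - frag_of (m, p, q) - frag_of (m, p', q) |m p p' q. True} \<union>
     {frag_of (m, p, q + q') - frag_of (m, p, q) - frag_of (m, p, q') |m p q q'. True} \<union>
     {frag_of (rM m r, p, q) - frag_of (m, lP r p, q) |m r p q. True} \<union>
     {frag_of (m, rP p r, q) - frag_of (m, p, lQ r q) |m p r q. True})"

definition tensor3 ::
  "('m::plus \<Rightarrow> 'r \<Rightarrow> 'm) \<Rightarrow> ('r \<Rightarrow> 'p::plus \<Rightarrow> 'p) \<Rightarrow> ('p \<Rightarrow> 'r \<Rightarrow> 'p) \<Rightarrow> ('r \<Rightarrow> 'q::plus \<Rightarrow> 'q) \<Rightarrow>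
   ('m \<times> 'p \<times> 'q \<Rightarrow>\<^sub>0 int) set set" where
  "tensor3 rM lP rP lQ = range (\<lambda>f. f +o tensor3_rel rM lP rP lQ)"

text \<open>
  The structure maps of a tensor product of two bimodules. The scalar action of the ground ring is
  the one of the first factor; it coincides with that of the second factor.
\<close>

definition tensor2_scl ::
  "('m::plus \<Rightarrow> 'r \<Rightarrow> 'm) \<Rightarrow> ('r \<Rightarrow> 'p::plus \<Rightarrow> 'p) \<Rightarrow> ('k \<Rightarrow> 'm \<Rightarrow> 'm) \<Rightarrow>
   'k \<Rightarrow> ('m \<times> 'p \<Rightarrow>\<^sub>0 int) set \<Rightarrow> ('m \<times> 'p \<Rightarrow>\<^sub>0 int) set" where
  "tensor2_scl rM lP sM c = quot_map (tensor2_rel rM lP) (\<lambda>(m, p). (sM c m, p))"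

definition tensor2_left ::
  "('m::plus \<Rightarrow> 'r \<Rightarrow> 'm) \<Rightarrow> ('r \<Rightarrow> 'p::plus \<Rightarrow> 'p) \<Rightarrow> ('r \<Rightarrow> 'm \<Rightarrow> 'm) \<Rightarrow>
   'r \<Rightarrow> ('m \<times> 'p \<Rightarrow>\<^sub>0 int) set \<Rightarrow> ('m \<times> 'p \<Rightarrow>\<^sub>0 int) set" where
  "tensor2_left rM lP lM r = quot_map (tensor2_rel rM lP) (\<lambda>(m, p). (lM r m, p))"

definition tensor2_right ::
  "('m::plus \<Rightarrow> 'r \<Rightarrow> 'm) \<Rightarrow> ('r \<Rightarrow> 'p::plus \<Rightarrow> 'p) \<Rightarrow> ('p \<Rightarrow> 'r \<Rightarrow> 'p) \<Rightarrow>
   ('m \<times> 'p \<Rightarrow>\<^sub>0 int) set \<Rightarrow> 'r \<Rightarrow> ('m \<times> 'p \<Rightarrow>\<^sub>0 int) set" where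
  "tensor2_right rM lP rP C r = quot_map (tensor2_rel rM lP) (\<lambda>(m, p). (m, rP p r)) C"


section \<open>Corings and right bialgebroids\<close>

text \<open>
  In Sweedler notation, the counit axioms say \<open>\<epsilon>(c\<^sup>1)\<cdot>c\<^sup>2 = c = c\<^sup>1\<cdot>\<epsilon>(c\<^sup>2)\<close>. An element of
  \<open>\<Delta> c\<close> is a formal sum representing the tensor \<open>\<Delta> c\<close>, so a universal quantification over it
  means that the formula holds for every way of writing \<open>\<Delta> c\<close> in Sweedler notation.
\<close>

locale coring = bimodule sR sC la ra
  for sR :: "'k::{comm_ring,comm_monoid_mult} \<Rightarrow> 'r::{ring,monoid_mult} \<Rightarrow> 'r"
    and sC :: "'k \<Rightarrow> 'c::ab_group_add \<Rightarrow> 'c"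
    and la :: "'r \<Rightarrow> 'c \<Rightarrow> 'c" and ra :: "'c \<Rightarrow> 'r \<Rightarrow> 'c" +
  fixes \<Delta> :: "'c \<Rightarrow> ('c \<times> 'c \<Rightarrow>\<^sub>0 int) set" and \<epsilon> :: "'c \<Rightarrow> 'r"
  assumes comult_bimodule_map:
    "bimodule_map UNIV sC la ra
      (tensor2 ra la) (tensor2_scl ra la sC) (tensor2_left ra la la) (tensor2_right ra la ra) \<Delta>"
    and counit_bimodule_map: "bimodule_map UNIV sC la ra UNIV sR (*) (*) \<epsilon>"
    and coassoc:
      "quot_extend (tensor3_rel ra la ra la)
         (\<lambda>(a, b). quot_map (tensor3_rel ra la ra la) (\<lambda>(a', a''). (a', a'', b)) (\<Delta> a)) (\<Delta> c) =
       quot_extend (tensor3_rel ra la ra la)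
         (\<lambda>(a, b). quot_map (tensor3_rel ra la ra la) (\<lambda>(b', b''). (a, b', b'')) (\<Delta> b)) (\<Delta> c)"
    and counit_left: "f \<in> \<Delta> c \<Longrightarrow> frag_eval (\<lambda>(a, b). la (\<epsilon> a) b) f = c"
    and counit_right: "f \<in> \<Delta> c \<Longrightarrow> frag_eval (\<lambda>(a, b). ra a (\<epsilon> b)) f = c"

text \<open>
  The bimodule structure of a right bialgebroid is \<open>r\<^sub>1 \<cdot> b \<cdot> r\<^sub>2 = b \<zeta>(r\<^sub>1) \<xi>(r\<^sub>2)\<close>.
\<close>

abbreviation base_left :: "('r \<Rightarrow> 'b::times) \<Rightarrow> 'r \<Rightarrow> 'b \<Rightarrow> 'b" where
  "base_left \<zeta> \<equiv> \<lambda>r b. b * \<zeta> r"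

abbreviation base_right :: "('r \<Rightarrow> 'b::times) \<Rightarrow> 'b \<Rightarrow> 'r \<Rightarrow> 'b" where
  "base_right \<xi> \<equiv> \<lambda>b r. b * \<xi> r"

locale right_bialgebroid =
  R: k_algebra sR + B: k_algebra sB + coring sR sB "base_left \<zeta>" "base_right \<xi>" \<Delta> \<epsilon>
  for sR :: "'k::{comm_ring,comm_monoid_mult} \<Rightarrow> 'r::{ring,monoid_mult} \<Rightarrow> 'r"
    and sB :: "'k \<Rightarrow> 'b::{ring,monoid_mult} \<Rightarrow> 'b"
    and \<xi> :: "'r \<Rightarrow> 'b" and \<zeta> :: "'r \<Rightarrow> 'b"
    and \<Delta> :: "'b \<Rightarrow> ('b \<times> 'b \<Rightarrow>\<^sub>0 int) set" and \<epsilon> :: "'b \<Rightarrow> 'r" +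
  assumes source_hom: "k_algebra_hom sR sB \<xi>"
    and target_hom: "k_algebra_antihom sR sB \<zeta>"
    and ranges_commute: "\<xi> r * \<zeta> r' = \<zeta> r' * \<xi> r"
    and takeuchi:
      "quot_map (tensor2_rel (base_right \<xi>) (base_left \<zeta>)) (\<lambda>(a, a'). (\<xi> r * a, a')) (\<Delta> b) =
       quot_map (tensor2_rel (base_right \<xi>) (base_left \<zeta>)) (\<lambda>(a, a'). (a, \<zeta> r * a')) (\<Delta> b)"
    and comult_one: "\<Delta> 1 = frag_of (1, 1) +o tensor2_rel (base_right \<xi>) (base_left \<zeta>)"
    and comult_mult: "f \<in> \<Delta> b \<Longrightarrow> f' \<in> \<Delta> b' \<Longrightarrow>
      \<Delta> (b * b') = componentwise_mult f f' +o tensor2_rel (base_right \<xi>) (base_left \<zeta>)"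
    and counit_one: "\<epsilon> 1 = 1"
    and counit_mult: "\<epsilon> (b * b') = \<epsilon> (\<xi> (\<epsilon> b) * b')"


section \<open>Comodules and comodule algebras\<close>

locale right_comodule =
  bialg: right_bialgebroid sR sB \<xi> \<zeta> \<Delta> \<epsilon> + right_module sR sV rV
  for sR :: "'k::{comm_ring,comm_monoid_mult} \<Rightarrow> 'r::{ring,monoid_mult} \<Rightarrow> 'r"
    and sB :: "'k \<Rightarrow> 'b::{ring,monoid_mult} \<Rightarrow> 'b"
    and \<xi> :: "'r \<Rightarrow> 'b" and \<zeta> :: "'r \<Rightarrow> 'b"
    and \<Delta> :: "'b \<Rightarrow> ('b \<times> 'b \<Rightarrow>\<^sub>0 int) set" and \<epsilon> :: "'b \<Rightarrow> 'r"
    and sV :: "'k \<Rightarrow> 'v::ab_group_add \<Rightarrow> 'v" and rV :: "'v \<Rightarrow> 'r \<Rightarrow> 'v" +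
  fixes \<rho> :: "'v \<Rightarrow> ('v \<times> 'b \<Rightarrow>\<^sub>0 int) set"
  assumes coact_linear:
    "k_linear UNIV sV (tensor2 rV (base_left \<zeta>)) (tensor2_scl rV (base_left \<zeta>) sV) \<rho>"
    and coact_right: "\<rho> (rV v r) = tensor2_right rV (base_left \<zeta>) (base_right \<xi>) (\<rho> v) r"
    and coact_coassoc:
      "quot_extend (tensor3_rel rV (base_left \<zeta>) (base_right \<xi>) (base_left \<zeta>))
         (\<lambda>(u, b). quot_map (tensor3_rel rV (base_left \<zeta>) (base_right \<xi>) (base_left \<zeta>))
            (\<lambda>(u', b'). (u', b', b)) (\<rho> u)) (\<rho> v) =
       quot_extend (tensor3_rel rV (base_left \<zeta>) (base_right \<xi>) (base_left \<zeta>))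
         (\<lambda>(u, b). quot_map (tensor3_rel rV (base_left \<zeta>) (base_right \<xi>) (base_left \<zeta>))
            (\<lambda>(b', b''). (u, b', b'')) (\<Delta> b)) (\<rho> v)"
    and coact_counit: "f \<in> \<rho> v \<Longrightarrow> frag_eval (\<lambda>(u, b). rV u (\<epsilon> b)) f = v"

text \<open>
  The left action \<open>r \<cdot> v = v\<^sup>0 \<cdot> \<epsilon>(\<xi>(r) v\<^sup>1)\<close> of the base algebra on a right comodule; in a comodule
  the value is the same for all representatives of \<open>\<rho> v\<close>.
\<close>

definition comodule_left ::
  "('r \<Rightarrow> 'b::times) \<Rightarrow> ('b \<Rightarrow> 'r) \<Rightarrow> ('v::ab_group_add \<Rightarrow> 'r \<Rightarrow> 'v) \<Rightarrow>
   ('v \<Rightarrow> ('v \<times> 'b \<Rightarrow>\<^sub>0 int) set) \<Rightarrow> 'r \<Rightarrow> 'v \<Rightarrow> 'v" where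
  "comodule_left \<xi> \<epsilon> rV \<rho> r v = frag_eval (\<lambda>(u, b). rV u (\<epsilon> (\<xi> r * b))) (SOME f. f \<in> \<rho> v)"

text \<open>
  As in the definition of bialgebroids, multiplicativity of the coaction includes that the product
  of two tensors may be computed with arbitrary representatives.
\<close>

locale right_comodule_algebra =
  right_comodule sR sB \<xi> \<zeta> \<Delta> \<epsilon> sT rT \<rho> + T: k_algebra sT
  for sR :: "'k::{comm_ring,comm_monoid_mult} \<Rightarrow> 'r::{ring,monoid_mult} \<Rightarrow> 'r"
    and sB :: "'k \<Rightarrow> 'b::{ring,monoid_mult} \<Rightarrow> 'b"
    and \<xi> :: "'r \<Rightarrow> 'b" and \<zeta> :: "'r \<Rightarrow> 'b"
    and \<Delta> :: "'b \<Rightarrow> ('b \<times> 'b \<Rightarrow>\<^sub>0 int) set" and \<epsilon> :: "'b \<Rightarrow> 'r"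
    and sT :: "'k \<Rightarrow> 't::{ring,monoid_mult} \<Rightarrow> 't" and rT :: "'t \<Rightarrow> 'r \<Rightarrow> 't"
    and \<rho> :: "'t \<Rightarrow> ('t \<times> 'b \<Rightarrow>\<^sub>0 int) set" +
  assumes mult_balanced: "rT t r * t' = t * comodule_left \<xi> \<epsilon> rT \<rho> r t'"
    and coact_one: "\<rho> 1 = frag_of (1, 1) +o tensor2_rel rT (base_left \<zeta>)"
    and coact_mult: "f \<in> \<rho> t \<Longrightarrow> f' \<in> \<rho> t' \<Longrightarrow>
      \<rho> (t * t') = componentwise_mult f f' +o tensor2_rel rT (base_left \<zeta>)"


section \<open>Transposition maps\<close>

text \<open>The bimodule structure of an algebra \<open>T\<close> over \<open>R\<close> given by an algebra map \<open>\<phi> : R \<rightarrow> T\<close>:\<close>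

abbreviation ring_left :: "('r \<Rightarrow> 't::times) \<Rightarrow> 'r \<Rightarrow> 't \<Rightarrow> 't" where
  "ring_left \<phi> \<equiv> \<lambda>r t. \<phi> r * t"

abbreviation ring_right :: "('r \<Rightarrow> 't::times) \<Rightarrow> 't \<Rightarrow> 'r \<Rightarrow> 't" where
  "ring_right \<phi> \<equiv> \<lambda>t r. t * \<phi> r"

text \<open>
  In \<open>trans_unit\<close> the element \<open>x\<close> of \<open>X\<close> corresponds to \<open>x \<otimes> 1\<close> in \<open>X \<otimes>\<^sub>R R\<close> and to
  \<open>1 \<otimes> x\<close> in \<open>R \<otimes>\<^sub>R X\<close>. The right-hand side of \<open>trans_mult\<close> passes through
  \<open>T \<otimes>\<^sub>R X \<otimes>\<^sub>R T\<close> and \<open>T \<otimes>\<^sub>R T \<otimes>\<^sub>R X\<close>.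
\<close>

locale transposition_map =
  R: k_algebra sR + T: k_algebra sT + X: bimodule sR sX lX rX
  for sR :: "'k::{comm_ring,comm_monoid_mult} \<Rightarrow> 'r::{ring,monoid_mult} \<Rightarrow> 'r"
    and sT :: "'k \<Rightarrow> 't::{ring,monoid_mult} \<Rightarrow> 't" and \<phi> :: "'r \<Rightarrow> 't"
    and sX :: "'k \<Rightarrow> 'x::ab_group_add \<Rightarrow> 'x"
    and lX :: "'r \<Rightarrow> 'x \<Rightarrow> 'x" and rX :: "'x \<Rightarrow> 'r \<Rightarrow> 'x" +
  fixes w :: "('x \<times> 't \<Rightarrow>\<^sub>0 int) set \<Rightarrow> ('t \<times> 'x \<Rightarrow>\<^sub>0 int) set"
  assumes trans_hom: "k_algebra_hom sR sT \<phi>"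
    and trans_bimodule_map:
      "bimodule_map
        (tensor2 rX (ring_left \<phi>)) (tensor2_scl rX (ring_left \<phi>) sX)
        (tensor2_left rX (ring_left \<phi>) lX) (tensor2_right rX (ring_left \<phi>) (ring_right \<phi>))
        (tensor2 (ring_right \<phi>) lX) (tensor2_scl (ring_right \<phi>) lX sT)
        (tensor2_left (ring_right \<phi>) lX (ring_left \<phi>)) (tensor2_right (ring_right \<phi>) lX rX) w"
    and trans_unit:
      "w (frag_of (x, \<phi> 1) +o tensor2_rel rX (ring_left \<phi>)) =
       frag_of (\<phi> 1, x) +o tensor2_rel (ring_right \<phi>) lX"
    and trans_mult:
      "z \<in> tensor3 rX (ring_left \<phi>) (ring_right \<phi>) (ring_left \<phi>) \<Longrightarrow>
       w (quot_map (tensor2_rel rX (ring_left \<phi>)) (\<lambda>(x, t, t'). (x, t * t')) z) =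
       quot_map (tensor2_rel (ring_right \<phi>) lX) (\<lambda>(t, t', x). (t * t', x))
         (quot_extend (tensor3_rel (ring_right \<phi>) (ring_left \<phi>) (ring_right \<phi>) lX)
            (\<lambda>(t, x, t').
               quot_map (tensor3_rel (ring_right \<phi>) (ring_left \<phi>) (ring_right \<phi>) lX)
                 (\<lambda>(s, y). (t, s, y)) (w (frag_of (x, t') +o tensor2_rel rX (ring_left \<phi>))))
            (quot_extend (tensor3_rel (ring_right \<phi>) lX rX (ring_left \<phi>))
               (\<lambda>(x, t, t').
                  quot_map (tensor3_rel (ring_right \<phi>) lX rX (ring_left \<phi>))
                    (\<lambda>(s, y). (s, y, t')) (w (frag_of (x, t) +o tensor2_rel rX (ring_left \<phi>))))
               z))"


section \<open>Cosimplicial modules and para-cocyclic structures\<close>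

text \<open>
  The coface \<open>d n k\<close> is the map \<open>d\<^sub>k : Z\<^sup>n\<^sup>-\<^sup>1 \<rightarrow> Z\<^sup>n\<close> (for \<open>n \<ge> 1\<close>) and the codegeneracy \<open>s n k\<close> is the
  map \<open>s\<^sub>k : Z\<^sup>n\<^sup>+\<^sup>1 \<rightarrow> Z\<^sup>n\<close>, both for \<open>k \<le> n\<close>.
\<close>

locale cosimplicial_module =
  fixes Z :: "nat \<Rightarrow> 'z::ab_semigroup_add set" and zero :: "nat \<Rightarrow> 'z"
    and scl :: "nat \<Rightarrow> 'k::{comm_ring,comm_monoid_mult} \<Rightarrow> 'z \<Rightarrow> 'z"
    and d :: "nat \<Rightarrow> nat \<Rightarrow> 'z \<Rightarrow> 'z" and s :: "nat \<Rightarrow> nat \<Rightarrow> 'z \<Rightarrow> 'z"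
  assumes module: "k_module_on (Z n) (zero n) (scl n)"
    and coface_linear:
      "k \<le> Suc n \<Longrightarrow> k_linear (Z n) (scl n) (Z (Suc n)) (scl (Suc n)) (d (Suc n) k)"
    and codegen_linear:
      "k \<le> n \<Longrightarrow> k_linear (Z (Suc n)) (scl (Suc n)) (Z n) (scl n) (s n k)"
    and coface_coface: "i < j \<Longrightarrow> j \<le> n + 2 \<Longrightarrow> z \<in> Z n \<Longrightarrow>
      d (n + 2) j (d (n + 1) i z) = d (n + 2) i (d (n + 1) (j - 1) z)"
    and codegen_codegen: "i \<le> j \<Longrightarrow> j \<le> n \<Longrightarrow> z \<in> Z (n + 2) \<Longrightarrow>
      s n j (s (n + 1) i z) = s n i (s (n + 1) (j + 1) z)"
    and codegen_coface_less: "i < j \<Longrightarrow> j \<le> n \<Longrightarrow> z \<in> Z n \<Longrightarrow>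
      s n j (d (n + 1) i z) = d n i (s (n - 1) (j - 1) z)"
    and codegen_coface_id: "i = j \<or> i = j + 1 \<Longrightarrow> j \<le> n \<Longrightarrow> z \<in> Z n \<Longrightarrow>
      s n j (d (n + 1) i z) = z"
    and codegen_coface_greater: "j + 1 < i \<Longrightarrow> i \<le> n + 1 \<Longrightarrow> z \<in> Z n \<Longrightarrow>
      s n j (d (n + 1) i z) = d n (i - 1) (s (n - 1) j z)"

locale para_cocyclic_module = cosimplicial_module Z zero scl d s
  for Z :: "nat \<Rightarrow> 'z::ab_semigroup_add set" and zero :: "nat \<Rightarrow> 'z"
    and scl :: "nat \<Rightarrow> 'k::{comm_ring,comm_monoid_mult} \<Rightarrow> 'z \<Rightarrow> 'z"
    and d :: "nat \<Rightarrow> nat \<Rightarrow> 'z \<Rightarrow> 'z" and s :: "nat \<Rightarrow> nat \<Rightarrow> 'z \<Rightarrow> 'z" +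
  fixes w :: "nat \<Rightarrow> 'z \<Rightarrow> 'z"
  assumes para_linear: "k_linear (Z n) (scl n) (Z n) (scl n) (w n)"
    and para_coface_0: "1 \<le> n \<Longrightarrow> z \<in> Z (n - 1) \<Longrightarrow> w n (d n 0 z) = d n n z"
    and para_coface: "1 \<le> k \<Longrightarrow> k \<le> n \<Longrightarrow> z \<in> Z (n - 1) \<Longrightarrow>
      w n (d n k z) = d n (k - 1) (w (n - 1) z)"
    and para_codegen_0: "z \<in> Z (n + 1) \<Longrightarrow> w n (s n 0 z) = s n n (w (n + 1) (w (n + 1) z))"
    and para_codegen: "1 \<le> k \<Longrightarrow> k \<le> n \<Longrightarrow> z \<in> Z (n + 1) \<Longrightarrow>
      w n (s n k z) = s n (k - 1) (w (n + 1) z)"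


section \<open>The cyclic tensor products of copies of T and one X\<close>

text \<open>
  The \<open>n\<close>-th module is a quotient of the free abelian group on the generators
  \<open>([t\<^sub>0, \<dots>, t\<^sub>n], x)\<close>. The relators \<open>chain_relators\<close> present the ordinary tensor product of
  bimodules \<open>T \<otimes>\<^sub>R \<dots> \<otimes>\<^sub>R T \<otimes>\<^sub>R X\<close>, and \<open>cyclic_relators\<close> are the elements \<open>r \<cdot> y - y \<cdot> r\<close>.
\<close>

definition chain_free :: "nat \<Rightarrow> ('t list \<times> 'x \<Rightarrow>\<^sub>0 int) set" where
  "chain_free n = {f. \<forall>(ts, x) \<in> Poly_Mapping.keys f. length ts = Suc n}"

definition chain_relators ::
  "('r \<Rightarrow> 't::plus \<Rightarrow> 't) \<Rightarrow> ('t \<Rightarrow> 'r \<Rightarrow> 't) \<Rightarrow> ('r \<Rightarrow> 'x::plus \<Rightarrow> 'x) \<Rightarrow> nat \<Rightarrow>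
   ('t list \<times> 'x \<Rightarrow>\<^sub>0 int) set" where
  "chain_relators lT rT lX n =
     {frag_of (us @ (a + b) # vs, x) - frag_of (us @ a # vs, x) - frag_of (us @ b # vs, x)
        |us a b vs x. length us + length vs = n} \<union>
     {frag_of (ts, x + y) - frag_of (ts, x) - frag_of (ts, y) |ts x y. length ts = Suc n} \<union>
     {frag_of (us @ rT a r # b # vs, x) - frag_of (us @ a # lT r b # vs, x)
        |us a r b vs x. Suc (length us + length vs) = n} \<union>
     {frag_of (us @ [rT a r], x) - frag_of (us @ [a], lX r x) |us a r x. length us = n}"

definition cyclic_relators ::
  "('r \<Rightarrow> 't \<Rightarrow> 't) \<Rightarrow> ('x \<Rightarrow> 'r \<Rightarrow> 'x) \<Rightarrow> nat \<Rightarrow> ('t list \<times> 'x \<Rightarrow>\<^sub>0 int) set" where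
  "cyclic_relators lT rX n =
     {frag_extend (\<lambda>(ts, x). frag_of (lT r (hd ts) # tl ts, x)) y -
      frag_extend (\<lambda>(ts, x). frag_of (ts, rX x r)) y |r y. y \<in> chain_free n}"

definition cyc_rel ::
  "('r \<Rightarrow> 't::plus \<Rightarrow> 't) \<Rightarrow> ('t \<Rightarrow> 'r \<Rightarrow> 't) \<Rightarrow> ('r \<Rightarrow> 'x::plus \<Rightarrow> 'x) \<Rightarrow> ('x \<Rightarrow> 'r \<Rightarrow> 'x) \<Rightarrow>
   nat \<Rightarrow> ('t list \<times> 'x \<Rightarrow>\<^sub>0 int) set" where
  "cyc_rel lT rT lX rX n = group_closure (chain_relators lT rT lX n \<union> cyclic_relators lT rX n)"

definition cyc_tensor ::
  "('r \<Rightarrow> 't::plus \<Rightarrow> 't) \<Rightarrow> ('t \<Rightarrow> 'r \<Rightarrow> 't) \<Rightarrow> ('r \<Rightarrow> 'x::plus \<Rightarrow> 'x) \<Rightarrow> ('x \<Rightarrow> 'r \<Rightarrow> 'x) \<Rightarrow>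
   nat \<Rightarrow> ('t list \<times> 'x \<Rightarrow>\<^sub>0 int) set set" where
  "cyc_tensor lT rT lX rX n = (\<lambda>f. f +o cyc_rel lT rT lX rX n) ` chain_free n"

definition cyc_scl ::
  "('r \<Rightarrow> 't::plus \<Rightarrow> 't) \<Rightarrow> ('t \<Rightarrow> 'r \<Rightarrow> 't) \<Rightarrow> ('r \<Rightarrow> 'x::plus \<Rightarrow> 'x) \<Rightarrow> ('x \<Rightarrow> 'r \<Rightarrow> 'x) \<Rightarrow>
   ('k \<Rightarrow> 'x \<Rightarrow> 'x) \<Rightarrow> nat \<Rightarrow> 'k \<Rightarrow> ('t list \<times> 'x \<Rightarrow>\<^sub>0 int) set \<Rightarrow> ('t list \<times> 'x \<Rightarrow>\<^sub>0 int) set" where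
  "cyc_scl lT rT lX rX sX n c = quot_map (cyc_rel lT rT lX rX n) (\<lambda>(ts, x). (ts, sX c x))"

definition cyc_coface ::
  "('r \<Rightarrow> 't::{plus,one} \<Rightarrow> 't) \<Rightarrow> ('t \<Rightarrow> 'r \<Rightarrow> 't) \<Rightarrow> ('r \<Rightarrow> 'x::plus \<Rightarrow> 'x) \<Rightarrow> ('x \<Rightarrow> 'r \<Rightarrow> 'x) \<Rightarrow>
   nat \<Rightarrow> nat \<Rightarrow> ('t list \<times> 'x \<Rightarrow>\<^sub>0 int) set \<Rightarrow> ('t list \<times> 'x \<Rightarrow>\<^sub>0 int) set" where
  "cyc_coface lT rT lX rX n k =
     quot_map (cyc_rel lT rT lX rX n) (\<lambda>(ts, x). (take k ts @ 1 # drop k ts, x))"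

definition cyc_codegen ::
  "('r \<Rightarrow> 't::{plus,times} \<Rightarrow> 't) \<Rightarrow> ('t \<Rightarrow> 'r \<Rightarrow> 't) \<Rightarrow> ('r \<Rightarrow> 'x::plus \<Rightarrow> 'x) \<Rightarrow> ('x \<Rightarrow> 'r \<Rightarrow> 'x) \<Rightarrow>
   nat \<Rightarrow> nat \<Rightarrow> ('t list \<times> 'x \<Rightarrow>\<^sub>0 int) set \<Rightarrow> ('t list \<times> 'x \<Rightarrow>\<^sub>0 int) set" where
  "cyc_codegen lT rT lX rX n k =
     quot_map (cyc_rel lT rT lX rX n)
       (\<lambda>(ts, x). (take k ts @ (ts ! k * ts ! Suc k) # drop (k + 2) ts, x))"

end

theory Submission
  imports Defs
begin

text \<open>
  Choose a representative \<open>t\<^sup>0 \<otimes> t\<^sup>1\<close> of each coaction \<open>\<rho> t\<close> and let \<open>x \<otimes> t \<mapsto> t\<^sup>0 \<otimes> x t\<^sup>1\<close> act on free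
  abelian groups. Every identity then becomes a congruence modulo relators that is additive, so it
  needs checking on generators only. Compatibility with the left action of \<open>R\<close> on \<open>T \<otimes>\<^sub>R X\<close> is the
  Takeuchi property \<open>r t\<^sup>0 \<otimes> t\<^sup>1 = t\<^sup>0 \<otimes> \<zeta>(r) t\<^sup>1\<close>, and compatibility with the multiplication of
  \<open>T\<close> is that of \<open>\<rho>\<close>. The operator \<open>w\<^sub>n\<close> moves \<open>t\<^sub>0\<close> to the end of the word and then applies the
  transposition map to \<open>x \<otimes> t\<^sub>0\<close>: it is well defined because the word is cyclic, and its relations
  with \<open>d\<^sub>0\<close> and \<open>s\<^sub>0\<close> are unitality and multiplicativity of the transposition map.
\<close>

section \<open>Cosets in free abelian groups\<close>

text \<open>Zero and differences mirror the generating rules of \<open>group_closure\<close>.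
  Throughout, \<open>x - y \<in> N\<close> serves as congruence modulo \<open>N\<close>.\<close>

definition add_subgroup :: "'a::ab_group_add set \<Rightarrow> bool" where
  "add_subgroup N \<longleftrightarrow> 0 \<in> N \<and> (\<forall>x\<in>N. \<forall>y\<in>N. x - y \<in> N)"

lemma add_subgroup_zero: "add_subgroup N \<Longrightarrow> 0 \<in> N"
  by (simp add: add_subgroup_def)

lemma add_subgroup_diff: "add_subgroup N \<Longrightarrow> x \<in> N \<Longrightarrow> y \<in> N \<Longrightarrow> x - y \<in> N"
  by (simp add: add_subgroup_def)

lemma add_subgroup_minus: "add_subgroup N \<Longrightarrow> x \<in> N \<Longrightarrow> - x \<in> N"
  using add_subgroup_diff [of N 0 x] by (simp add: add_subgroup_zero)

lemma add_subgroup_add: "add_subgroup N \<Longrightarrow> x \<in> N \<Longrightarrow> y \<in> N \<Longrightarrow> x + y \<in> N"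
  using add_subgroup_diff [of N x "- y"] by (simp add: add_subgroup_minus)

lemma add_subgroup_cong_sym: "add_subgroup N \<Longrightarrow> x - y \<in> N \<Longrightarrow> y - x \<in> N"
  using add_subgroup_minus [of N "x - y"] by simp

lemma add_subgroup_cong_trans: "add_subgroup N \<Longrightarrow> x - y \<in> N \<Longrightarrow> y - z \<in> N \<Longrightarrow> x - z \<in> N"
  using add_subgroup_add [of N "x - y" "y - z"] by simp

lemma add_subgroup_cong_common:
  "add_subgroup N \<Longrightarrow> x - z \<in> N \<Longrightarrow> y - z \<in> N \<Longrightarrow> x - y \<in> N"
  using add_subgroup_diff [of N "x - z" "y - z"] by simp

lemma add_subgroup_group_closure [simp]: "add_subgroup (group_closure S)"
  by (simp add: add_subgroup_def group_closure.diff)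

lemma group_closure_subset:
  assumes "add_subgroup N" and "S \<subseteq> N"
  shows "group_closure S \<subseteq> N"
proof
  fix x assume "x \<in> group_closure S"
  then show "x \<in> N"
    by induction (use assms in \<open>auto simp: add_subgroup_zero add_subgroup_diff\<close>)
qed

text \<open>Translates equality of tensors into membership of a formal sum in the subgroup of
  relators, the form in which the later congruences are proved.\<close>

lemma coset_eq_iff:
  fixes f g :: "'a::ab_group_add"
  assumes "add_subgroup N"
  shows "f +o N = g +o N \<longleftrightarrow> f - g \<in> N"
proof
  assume "f +o N = g +o N"
  moreover have "f \<in> f +o N"
    using set_plus_intro2 [of 0 N f] assms by (simp add: add_subgroup_zero)
  ultimately show "f - g \<in> N"
    by (simp add: set_minus_plus)
next
  assume fg: "f - g \<in> N"
  have "x - f \<in> N \<longleftrightarrow> x - g \<in> N" for x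
    using add_subgroup_cong_trans [OF assms] add_subgroup_cong_sym [OF assms fg] fg by blast
  then show "f +o N = g +o N"
    by (auto simp flip: set_minus_plus)
qed

lemma mem_own_coset: "add_subgroup N \<Longrightarrow> f \<in> f +o N"
  by (simp add: add_subgroup_zero flip: set_minus_plus)

lemma coset_rep_eq: "add_subgroup N \<Longrightarrow> g \<in> f +o N \<Longrightarrow> f +o N = g +o N"
  by (metis add_subgroup_cong_sym coset_eq_iff set_minus_plus)

lemma add_subgroup_plus_self:
  assumes "add_subgroup N"
  shows "N + N = N"
proof
  show "N + N \<subseteq> N"
    using assms by (auto simp: set_plus_def add_subgroup_add)
  show "N \<subseteq> N + N"
    using assms by (rule set_zero_plus2 [OF add_subgroup_zero])
qed

lemma coset_plus:
  "add_subgroup N \<Longrightarrow> (f +o N) + (g +o N) = (f + g) +o N"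
  by (simp add: set_plus_rearrange add_subgroup_plus_self)

section \<open>Additive extensions of maps on generators\<close>

lemma frag_extend_frag_extend:
  "frag_extend h (frag_extend g f) = frag_extend (\<lambda>x. frag_extend h (g x)) f"
  using subset_UNIV [of "Poly_Mapping.keys f"]
  by (induction f rule: frag_induction) (auto simp: frag_extend_diff)

lemma frag_extend_frag_of [simp]: "frag_extend frag_of f = f"
  by (rule frag_expansion [symmetric])

lemma frag_extend_fun_diff:
  "frag_extend (\<lambda>x. g x - h x) f = frag_extend g f - frag_extend h f"
  using subset_UNIV [of "Poly_Mapping.keys f"]
  by (induction f rule: frag_induction) (auto simp: frag_extend_diff)

text \<open>Only the generators that occur in \<open>f\<close> are tested, so a prescribed length of
  the words in \<open>f\<close> can be used.\<close>

lemma frag_extend_mem: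
  assumes N: "add_subgroup N" and "\<And>x. x \<in> Poly_Mapping.keys f \<Longrightarrow> h x \<in> N"
  shows "frag_extend h f \<in> N"
  using subset_refl
proof (induction f rule: frag_induction)
  case zero
  show ?case by (simp add: N add_subgroup_zero)
next
  case (one x)
  then show ?case by (simp add: assms)
next
  case (diff a b)
  then show ?case by (simp add: N frag_extend_diff add_subgroup_diff)
qed

lemma frag_extend_cong_mem:
  assumes "add_subgroup N" and "\<And>x. x \<in> Poly_Mapping.keys f \<Longrightarrow> g x - h x \<in> N"
  shows "frag_extend g f - frag_extend h f \<in> N"
  using frag_extend_mem [OF assms] by (simp add: frag_extend_fun_diff)

lemma frag_extend_additive_mem:
  assumes "add_subgroup N" and "\<And>x. x \<in> Poly_Mapping.keys f \<Longrightarrow> k x - g x - h x \<in> N"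
  shows "frag_extend k f - frag_extend g f - frag_extend h f \<in> N"
  using frag_extend_mem [OF assms] by (simp add: frag_extend_fun_diff)

section \<open>Maps induced between quotients of free abelian groups\<close>

definition compatible ::
  "('g \<Rightarrow>\<^sub>0 int) set \<Rightarrow> ('g \<Rightarrow> ('h \<Rightarrow>\<^sub>0 int)) \<Rightarrow> ('h \<Rightarrow>\<^sub>0 int) set \<Rightarrow> bool" where
  "compatible M e N \<longleftrightarrow> (\<forall>f\<in>M. frag_extend e f \<in> N)"

lemma compatibleD: "compatible M e N \<Longrightarrow> f \<in> M \<Longrightarrow> frag_extend e f \<in> N"
  by (simp add: compatible_def)

text \<open>The formal sums sent into \<open>N\<close> form a subgroup, so testing the relators is
  enough.\<close>

lemma compatible_group_closure:
  assumes N: "add_subgroup N" and S: "\<And>f. f \<in> S \<Longrightarrow> frag_extend e f \<in> N"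
  shows "compatible (group_closure S) e N"
proof -
  have "add_subgroup {f. frag_extend e f \<in> N}"
    unfolding add_subgroup_def by (simp add: N add_subgroup_zero add_subgroup_diff frag_extend_diff)
  then show ?thesis
    using group_closure_subset [of "{f. frag_extend e f \<in> N}" S] S
    by (auto simp: compatible_def)
qed

lemma compatible_comp:
  "compatible L g M \<Longrightarrow> compatible M h N \<Longrightarrow> compatible L (\<lambda>x. frag_extend h (g x)) N"
  by (simp add: compatible_def flip: frag_extend_frag_extend)

text \<open>Extends \<open>quot_map\<close> to an \<open>e\<close> whose values are formal sums,
  which the transposition needs because a coaction is a sum. The union over all representatives is
  kept so that \<open>quot_map\<close> is literally an instance.\<close>

definition coset_map ::
  "('h \<Rightarrow>\<^sub>0 int) set \<Rightarrow> ('g \<Rightarrow> ('h \<Rightarrow>\<^sub>0 int)) \<Rightarrow> ('g \<Rightarrow>\<^sub>0 int) set \<Rightarrow> ('h \<Rightarrow>\<^sub>0 int) set" where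
  "coset_map N e C = (\<Union>f\<in>C. frag_extend e f +o N)"

lemma quot_map_eq_coset_map: "quot_map N h = coset_map N (\<lambda>g. frag_of (h g))"
  by (simp add: fun_eq_iff quot_map_def coset_map_def)

text \<open>By compatibility every representative contributes the same coset to the union, and
  \<open>f\<close> itself is one of them.\<close>

lemma coset_map_coset:
  assumes N: "add_subgroup N" and M: "add_subgroup M" and e: "compatible M e N"
  shows "coset_map N e (f +o M) = frag_extend e f +o N"
proof -
  have "frag_extend e g +o N = frag_extend e f +o N" if "g \<in> f +o M" for g
    using compatibleD [OF e set_plus_imp_minus [OF that]]
    by (simp add: coset_eq_iff [OF N] frag_extend_diff)
  then show ?thesis
    using mem_own_coset [OF M, of f] unfolding coset_map_def by blast
qed

lemma quot_map_coset:
  assumes "add_subgroup N" and "add_subgroup M" and "compatible M (\<lambda>g. frag_of (h g)) N"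
  shows "quot_map N h (f +o M) = frag_extend (\<lambda>g. frag_of (h g)) f +o N"
  using coset_map_coset [OF assms] by (simp add: quot_map_eq_coset_map)

text \<open>\<open>quot_extend\<close> extends choices made by \<open>SOME\<close>. Any other choice
  \<open>e\<close> of representatives differs from them, generator by generator, by elements of
  \<open>N\<close>, so compatibility need only be known for a convenient \<open>e\<close>.\<close>

lemma quot_extend_coset:
  assumes N: "add_subgroup N" and M: "add_subgroup M" and e: "compatible M e N"
    and D: "\<And>g. D g = e g +o N"
  shows "quot_extend N D (f +o M) = frag_extend e f +o N"
proof -
  let ?s = "\<lambda>g. SOME u. u \<in> D g"
  have "?s g \<in> e g +o N" for g
    unfolding D by (rule someI) (rule mem_own_coset [OF N])
  then have s: "frag_extend ?s f' - frag_extend e f' \<in> N" for f'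
    by (intro frag_extend_cong_mem [OF N] set_plus_imp_minus)
  have "compatible M ?s N"
    unfolding compatible_def
  proof
    fix f' assume "f' \<in> M"
    then show "frag_extend ?s f' \<in> N"
      using add_subgroup_add [OF N s compatibleD [OF e], of f' f'] by simp
  qed
  from coset_map_coset [OF N M this, of f] s [of f] show ?thesis
    by (simp add: quot_extend_def coset_map_def coset_eq_iff [OF N])
qed


section \<open>Tensor products\<close>

lemma add_subgroup_tensor2_rel [simp]: "add_subgroup (tensor2_rel rM lP)"
  by (simp add: tensor2_rel_def)

lemma add_subgroup_tensor3_rel [simp]: "add_subgroup (tensor3_rel rM lP rP lQ)"
  by (simp add: tensor3_rel_def)

lemma tensor2_rel_add_left:
  "frag_of (m + m', p) - frag_of (m, p) - frag_of (m', p) \<in> tensor2_rel rM lP"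
  unfolding tensor2_rel_def by (rule group_closure.base) blast

lemma tensor2_rel_add_right:
  "frag_of (m, p + p') - frag_of (m, p) - frag_of (m, p') \<in> tensor2_rel rM lP"
  unfolding tensor2_rel_def by (rule group_closure.base) blast

lemma tensor2_rel_balanced:
  "frag_of (rM m r, p) - frag_of (m, lP r p) \<in> tensor2_rel rM lP"
  unfolding tensor2_rel_def by (rule group_closure.base) blast

lemmas tensor2_rel_intros = tensor2_rel_add_left tensor2_rel_add_right tensor2_rel_balanced

lemma tensor3_rel_add_1:
  "frag_of (m + m', p, q) - frag_of (m, p, q) - frag_of (m', p, q) \<in> tensor3_rel rM lP rP lQ"
  unfolding tensor3_rel_def by (rule group_closure.base) blast

lemma tensor3_rel_add_2:
  "frag_of (m, p + p', q) - frag_of (m, p, q) - frag_of (m, p', q) \<in> tensor3_rel rM lP rP lQ"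
  unfolding tensor3_rel_def by (rule group_closure.base) blast

lemma tensor3_rel_add_3:
  "frag_of (m, p, q + q') - frag_of (m, p, q) - frag_of (m, p, q') \<in> tensor3_rel rM lP rP lQ"
  unfolding tensor3_rel_def by (rule group_closure.base) blast

lemma tensor3_rel_balanced_12:
  "frag_of (rM m r, p, q) - frag_of (m, lP r p, q) \<in> tensor3_rel rM lP rP lQ"
  unfolding tensor3_rel_def by (rule group_closure.base) blast

lemma tensor3_rel_balanced_23:
  "frag_of (m, rP p r, q) - frag_of (m, p, lQ r q) \<in> tensor3_rel rM lP rP lQ"
  unfolding tensor3_rel_def by (rule group_closure.base) blast

lemmas tensor3_rel_intros =
  tensor3_rel_add_1 tensor3_rel_add_2 tensor3_rel_add_3
  tensor3_rel_balanced_12 tensor3_rel_balanced_23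

text \<open>Existence part of the universal property of the tensor product, modulo \<open>N\<close>:
  biadditive and balanced maps respect the relators.\<close>

lemma compatible_tensor2I:
  assumes "add_subgroup N"
    and "\<And>m m' p. e (m + m', p) - e (m, p) - e (m', p) \<in> N"
    and "\<And>m p p'. e (m, p + p') - e (m, p) - e (m, p') \<in> N"
    and "\<And>m r p. e (rM m r, p) - e (m, lP r p) \<in> N"
  shows "compatible (tensor2_rel rM lP) e N"
  unfolding tensor2_rel_def
  by (rule compatible_group_closure [OF assms(1)])
    (elim UnE CollectE exE conjE; simp only: frag_extend_diff frag_extend_of assms)

lemma compatible_tensor3I:
  assumes "add_subgroup N"
    and "\<And>m m' p q. e (m + m', p, q) - e (m, p, q) - e (m', p, q) \<in> N"
    and "\<And>m p p' q. e (m, p + p', q) - e (m, p, q) - e (m, p', q) \<in> N"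
    and "\<And>m p q q'. e (m, p, q + q') - e (m, p, q) - e (m, p, q') \<in> N"
    and "\<And>m r p q. e (rM m r, p, q) - e (m, lP r p, q) \<in> N"
    and "\<And>m p r q. e (m, rP p r, q) - e (m, p, lQ r q) \<in> N"
  shows "compatible (tensor3_rel rM lP rP lQ) e N"
  unfolding tensor3_rel_def
  by (rule compatible_group_closure [OF assms(1)])
    (elim UnE CollectE exE conjE; simp only: frag_extend_diff frag_extend_of assms)


section \<open>Cyclic tensor products\<close>

definition insert_one :: "nat \<Rightarrow> 't::one list \<Rightarrow> 't list" where
  "insert_one k ts = take k ts @ 1 # drop k ts"

definition merge_at :: "nat \<Rightarrow> 't::times list \<Rightarrow> 't list" where
  "merge_at k ts = take k ts @ (ts ! k * ts ! Suc k) # drop (k + 2) ts"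

lemma insert_one_0 [simp]: "insert_one 0 ts = 1 # ts"
  and insert_one_Suc [simp]: "insert_one (Suc k) (t # ts) = t # insert_one k ts"
  by (simp_all add: insert_one_def)

lemma merge_at_0 [simp]: "merge_at 0 (t # t' # ts) = t * t' # ts"
  and merge_at_Suc [simp]: "merge_at (Suc k) (t # ts) = t # merge_at k ts"
  by (simp_all add: merge_at_def)

lemma length_insert_one [simp]: "length (insert_one k ts) = Suc (length ts)"
  by (simp add: insert_one_def)

lemma length_merge_at [simp]: "Suc k < length ts \<Longrightarrow> length (merge_at k ts) = length ts - 1"
  by (simp add: merge_at_def)

lemma insert_one_append:
  "insert_one k (us @ vs) =
   (if k \<le> length us then insert_one k us @ vs else us @ insert_one (k - length us) vs)"
  by (simp add: insert_one_def)

lemma merge_at_append_left: "Suc k < length us \<Longrightarrow> merge_at k (us @ vs) = merge_at k us @ vs"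
  by (simp add: merge_at_def nth_append)

lemma merge_at_append_right: "length us \<le> k \<Longrightarrow> merge_at k (us @ vs) = us @ merge_at (k - length us) vs"
  by (simp add: merge_at_def nth_append Suc_diff_le)

text \<open>The merged pair straddles the boundary between the two words. With
  \<open>merge_at_append_left\<close> and \<open>merge_at_append_right\<close> this covers every
  position of the pair.\<close>

lemma merge_at_append_last:
  assumes "Suc k = length us"
  shows "merge_at k (us @ v # vs) = butlast us @ (last us * v) # vs"
proof -
  from assms obtain us' u where "us = us' @ [u]" "length us' = k"
    by (metis length_Suc_conv_rev)
  then show ?thesis
    by (simp add: merge_at_append_right)
qed

text \<open>The cosimplicial identities hold for words, before any relators are imposed. The
  induction strips a leading letter that neither operation touches, until one operation acts at
  position 0.\<close>

lemma insert_one_insert_one: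
  "i < j \<Longrightarrow> j \<le> Suc (length ts) \<Longrightarrow>
   insert_one j (insert_one i ts) = insert_one i (insert_one (j - 1) ts)"
proof (induction i arbitrary: j ts)
  case 0
  then show ?case by (cases j) auto
next
  case (Suc i)
  then obtain j' t ts' where "j = Suc (Suc j')" "ts = t # ts'"
    by (cases j; cases "j - 1"; cases ts) auto
  with Suc show ?case by simp
qed

lemma merge_at_merge_at:
  "i \<le> j \<Longrightarrow> j + 2 < length ts \<Longrightarrow>
   merge_at j (merge_at i ts) = merge_at i (merge_at (Suc j) (ts :: 't::semigroup_mult list))"
proof (induction i arbitrary: j ts)
  case 0
  then obtain a b c ts' where "ts = a # b # c # ts'"
    by (cases ts; cases "tl ts"; cases "tl (tl ts)") auto
  \<comment> \<open>For \<open>j = 0\<close> both sides multiply the first three letters, in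
    different bracketings.\<close>
  then show ?case by (cases j) (auto simp: mult.assoc)
next
  case (Suc i)
  then obtain j' t ts' where "j = Suc j'" "ts = t # ts'"
    by (cases j; cases ts) auto
  with Suc show ?case by simp
qed

lemma merge_at_insert_one_less:
  "i < j \<Longrightarrow> j < length ts \<Longrightarrow> merge_at j (insert_one i ts) = insert_one i (merge_at (j - 1) ts)"
proof (induction i arbitrary: j ts)
  case 0
  then show ?case by (cases j) auto
next
  case (Suc i)
  then obtain j' t ts' where "j = Suc (Suc j')" "ts = t # ts'"
    by (cases j; cases "j - 1"; cases ts) auto
  with Suc show ?case by simp
qed

lemma merge_at_insert_one_id:
  "i = j \<or> i = j + 1 \<Longrightarrow> j < length ts \<Longrightarrow> merge_at j (insert_one i ts) = (ts :: 't::monoid_mult list)"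
proof (induction j arbitrary: i ts)
  case 0
  then show ?case by (cases ts) auto
next
  case (Suc j)
  then obtain i' t ts' where "i = Suc i'" "ts = t # ts'"
    by (cases i; cases ts) auto
  with Suc show ?case by simp
qed

lemma merge_at_insert_one_greater:
  "j + 1 < i \<Longrightarrow> i \<le> length ts \<Longrightarrow> merge_at j (insert_one i ts) = insert_one (i - 1) (merge_at j ts)"
proof (induction j arbitrary: i ts)
  case 0
  then obtain i' a b ts' where "i = Suc (Suc i')" "ts = a # b # ts'"
    by (cases i; cases "i - 1"; cases ts; cases "tl ts") auto
  then show ?case by simp
next
  case (Suc j)
  then obtain i' t ts' where "i = Suc (Suc i')" "ts = t # ts'"
    by (cases i; cases "i - 1"; cases ts) auto
  with Suc show ?case by simp
qed

section \<open>Presentation of the cyclic tensor product by words\<close>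

lemma add_subgroup_chain_free [simp]: "add_subgroup (chain_free n)"
  unfolding add_subgroup_def
proof (intro conjI ballI)
  show "x - y \<in> chain_free n" if "x \<in> chain_free n" "y \<in> chain_free n"
    for x y :: "'t list \<times> 'x \<Rightarrow>\<^sub>0 int"
    using that keys_diff [of x y] unfolding chain_free_def by blast
qed (simp add: chain_free_def)

lemma frag_of_mem_chain_free [simp]: "frag_of (ts, x) \<in> chain_free n \<longleftrightarrow> length ts = Suc n"
  by (simp add: chain_free_def)

lemma add_subgroup_cyc_rel [simp]: "add_subgroup (cyc_rel lT rT lX rX n)"
  by (simp add: cyc_rel_def)

text \<open>The cyclic relators are given for arbitrary formal sums of words; by additivity those of
  single words suffice. Such words have \<open>n + 1\<close> letters, so \<open>hd\<close> and
  \<open>tl\<close> may be replaced by an explicit first letter.\<close>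

lemma compatible_cyc_relI:
  assumes N: "add_subgroup N"
    and "\<And>us a b vs x. length us + length vs = n \<Longrightarrow>
      e (us @ (a + b) # vs, x) - e (us @ a # vs, x) - e (us @ b # vs, x) \<in> N"
    and "\<And>ts x y. length ts = Suc n \<Longrightarrow> e (ts, x + y) - e (ts, x) - e (ts, y) \<in> N"
    and "\<And>us a r b vs x. Suc (length us + length vs) = n \<Longrightarrow>
      e (us @ rT a r # b # vs, x) - e (us @ a # lT r b # vs, x) \<in> N"
    and "\<And>us a r x. length us = n \<Longrightarrow> e (us @ [rT a r], x) - e (us @ [a], lX r x) \<in> N"
    and cyclic: "\<And>r t ts x. length ts = n \<Longrightarrow> e (lT r t # ts, x) - e (t # ts, rX x r) \<in> N"
  shows "compatible (cyc_rel lT rT lX rX n) e N"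
  unfolding cyc_rel_def
proof (rule compatible_group_closure [OF N])
  fix f assume "f \<in> chain_relators lT rT lX n \<union> cyclic_relators lT rX n"
  then consider "f \<in> chain_relators lT rT lX n" | "f \<in> cyclic_relators lT rX n" by blast
  then show "frag_extend e f \<in> N"
  proof cases
    case 1
    then show ?thesis
      unfolding chain_relators_def
      by (elim UnE CollectE exE conjE; simp only: frag_extend_diff frag_extend_of assms)
  next
    case 2
    then obtain r y where y: "y \<in> chain_free n"
      and f: "f = frag_extend (\<lambda>(ts, x). frag_of (lT r (hd ts) # tl ts, x)) y -
        frag_extend (\<lambda>(ts, x). frag_of (ts, rX x r)) y"
      unfolding cyclic_relators_def by blast
    show ?thesis
      unfolding f frag_extend_diff frag_extend_frag_extend
    proof (rule frag_extend_cong_mem [OF N], clarify)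
      fix ts x assume "(ts, x) \<in> Poly_Mapping.keys y"
      with y have "length ts = Suc n" by (auto simp: chain_free_def)
      then obtain t ts' where "ts = t # ts'" "length ts' = n" by (cases ts) auto
      then show "frag_extend e (frag_of (lT r (hd ts) # tl ts, x)) -
          frag_extend e (frag_of (ts, rX x r)) \<in> N"
        by (simp add: cyclic)
    qed
  qed
qed

section \<open>The cosimplicial module of a bimodule X and a map from R to T\<close>

locale ring_chain = bimodule sR sX lX rX
  for sR :: "'k::{comm_ring,comm_monoid_mult} \<Rightarrow> 'r::{ring,monoid_mult} \<Rightarrow> 'r"
    and sX :: "'k \<Rightarrow> 'x::ab_group_add \<Rightarrow> 'x"
    and lX :: "'r \<Rightarrow> 'x \<Rightarrow> 'x" and rX :: "'x \<Rightarrow> 'r \<Rightarrow> 'x" +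
  fixes \<phi> :: "'r \<Rightarrow> 't::{ring,monoid_mult}"
begin

abbreviation relations :: "nat \<Rightarrow> ('t list \<times> 'x \<Rightarrow>\<^sub>0 int) set" where
  "relations \<equiv> cyc_rel (ring_left \<phi>) (ring_right \<phi>) lX rX"

abbreviation chains :: "nat \<Rightarrow> ('t list \<times> 'x \<Rightarrow>\<^sub>0 int) set set" where
  "chains \<equiv> cyc_tensor (ring_left \<phi>) (ring_right \<phi>) lX rX"

abbreviation scalar :: "nat \<Rightarrow> 'k \<Rightarrow> ('t list \<times> 'x \<Rightarrow>\<^sub>0 int) set \<Rightarrow> ('t list \<times> 'x \<Rightarrow>\<^sub>0 int) set" where
  "scalar \<equiv> cyc_scl (ring_left \<phi>) (ring_right \<phi>) lX rX sX"

abbreviation coface :: "nat \<Rightarrow> nat \<Rightarrow> ('t list \<times> 'x \<Rightarrow>\<^sub>0 int) set \<Rightarrow> ('t list \<times> 'x \<Rightarrow>\<^sub>0 int) set" where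
  "coface \<equiv> cyc_coface (ring_left \<phi>) (ring_right \<phi>) lX rX"

abbreviation codegen :: "nat \<Rightarrow> nat \<Rightarrow> ('t list \<times> 'x \<Rightarrow>\<^sub>0 int) set \<Rightarrow> ('t list \<times> 'x \<Rightarrow>\<^sub>0 int) set" where
  "codegen \<equiv> cyc_codegen (ring_left \<phi>) (ring_right \<phi>) lX rX"

lemma rel_add:
  assumes "length us + length vs = n"
  shows "frag_of (us @ (a + b) # vs, x) - frag_of (us @ a # vs, x) - frag_of (us @ b # vs, x)
    \<in> relations n"
  unfolding cyc_rel_def chain_relators_def
  by (intro group_closure.base UnI1) (use assms in blast)

lemma rel_add_X:
  assumes "length ts = Suc n"
  shows "frag_of (ts, x + y) - frag_of (ts, x) - frag_of (ts, y) \<in> relations n"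
  unfolding cyc_rel_def chain_relators_def
  by (intro group_closure.base UnI1) (use assms in blast)

lemma rel_balanced:
  assumes "Suc (length us + length vs) = n"
  shows "frag_of (us @ (a * \<phi> r) # b # vs, x) - frag_of (us @ a # (\<phi> r * b) # vs, x)
    \<in> relations n"
  unfolding cyc_rel_def chain_relators_def
  by (intro group_closure.base UnI1) (use assms in blast)

lemma rel_balanced_X:
  assumes "length us = n"
  shows "frag_of (us @ [a * \<phi> r], x) - frag_of (us @ [a], lX r x) \<in> relations n"
  unfolding cyc_rel_def chain_relators_def
  by (intro group_closure.base UnI1) (use assms in blast)

lemma rel_cyclic:
  assumes "length ts = n"
  shows "frag_of ((\<phi> r * t) # ts, x) - frag_of (t # ts, rX x r) \<in> relations n"
proof -
  have "frag_of (t # ts, x) \<in> chain_free n"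
    using assms by simp
  then have "frag_extend (\<lambda>(ts, x). frag_of ((\<phi> r * hd ts) # tl ts, x)) (frag_of (t # ts, x)) -
      frag_extend (\<lambda>(ts, x). frag_of (ts, rX x r)) (frag_of (t # ts, x)) \<in> relations n"
    unfolding cyc_rel_def cyclic_relators_def by (intro group_closure.base UnI2) blast
  then show ?thesis
    by simp
qed

text \<open>Words of all lengths share one type, so besides respecting relators a map must send
  words of the source degree to sums of words of the target degree.\<close>

definition chain_hom :: "nat \<Rightarrow> nat \<Rightarrow> ('t list \<times> 'x \<Rightarrow> ('t list \<times> 'x \<Rightarrow>\<^sub>0 int)) \<Rightarrow> bool" where
  "chain_hom n m e \<longleftrightarrow> compatible (relations n) e (relations m) \<and>
    (\<forall>ts x. length ts = Suc n \<longrightarrow> e (ts, x) \<in> chain_free m)"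

lemma chain_hom_free:
  assumes "chain_hom n m e" and "f \<in> chain_free n"
  shows "frag_extend e f \<in> chain_free m"
proof (rule frag_extend_mem [OF add_subgroup_chain_free])
  fix g assume "g \<in> Poly_Mapping.keys f"
  with assms(2) have "length (fst g) = Suc n"
    by (auto simp: chain_free_def)
  with assms(1) show "e g \<in> chain_free m"
    by (cases g) (simp add: chain_hom_def)
qed

lemma chain_hom_coset:
  "chain_hom n m e \<Longrightarrow>
   coset_map (relations m) e (f +o relations n) = frag_extend e f +o relations m"
  by (simp add: chain_hom_def coset_map_coset)

lemma chains_cases:
  assumes "z \<in> chains n"
  obtains f where "f \<in> chain_free n" and "z = f +o relations n"
  using assms unfolding cyc_tensor_def by blast

lemma chainsI: "f \<in> chain_free n \<Longrightarrow> f +o relations n \<in> chains n"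
  unfolding cyc_tensor_def by blast

text \<open>An element of \<open>chains n\<close> is represented by a sum of words of
  \<open>n + 1\<close> letters, so congruence on such words determines the induced map.\<close>

lemma chain_hom_eqI:
  assumes z: "z \<in> chains n" and "chain_hom n m e" "chain_hom n m e'"
    and eq: "\<And>ts x. length ts = Suc n \<Longrightarrow> e (ts, x) - e' (ts, x) \<in> relations m"
  shows "coset_map (relations m) e z = coset_map (relations m) e' z"
proof -
  obtain f where f: "f \<in> chain_free n" and z: "z = f +o relations n"
    using z by (rule chains_cases)
  have "frag_extend e f - frag_extend e' f \<in> relations m"
    by (rule frag_extend_cong_mem) (use f eq in \<open>auto simp: chain_free_def\<close>)
  then show ?thesis
    by (simp add: z assms chain_hom_coset coset_eq_iff)
qed

lemma chain_hom_comp: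
  assumes "chain_hom n m e" "chain_hom m l g"
  shows "chain_hom n l (\<lambda>x. frag_extend g (e x))"
  using assms chain_hom_free [OF assms(2)] by (auto simp: chain_hom_def intro: compatible_comp)

lemma coset_map_comp:
  assumes "z \<in> chains n" "chain_hom n m e" "chain_hom m l g"
  shows "coset_map (relations l) g (coset_map (relations m) e z) =
    coset_map (relations l) (\<lambda>x. frag_extend g (e x)) z"
  using assms(1)
  by (rule chains_cases)
    (simp add: assms chain_hom_coset chain_hom_comp [OF assms(2,3)] frag_extend_frag_extend)

lemma coset_map_closed:
  "chain_hom n m e \<Longrightarrow> z \<in> chains n \<Longrightarrow> coset_map (relations m) e z \<in> chains m"
  by (auto elim!: chains_cases simp: chain_hom_coset chain_hom_free intro!: chainsI)

lemma chain_hom_frag_of: "chain_hom n n frag_of"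
  by (simp add: chain_hom_def compatible_def)

lemma coset_map_frag_of: "z \<in> chains n \<Longrightarrow> coset_map (relations n) frag_of z = z"
  by (auto elim!: chains_cases simp: chain_hom_coset [OF chain_hom_frag_of])

text \<open>The shape of the cosimplicial and para-cocyclic relations: two composites, possibly
  through different degrees \<open>m\<close> and \<open>m'\<close>, are compared on words of the
  source degree.\<close>

lemma comp_eqI:
  assumes "z \<in> chains n" "chain_hom n m e" "chain_hom m l g" "chain_hom n m' e'" "chain_hom m' l g'"
    and "\<And>ts x. length ts = Suc n \<Longrightarrow>
      frag_extend g (e (ts, x)) - frag_extend g' (e' (ts, x)) \<in> relations l"
  shows "coset_map (relations l) g (coset_map (relations m) e z) =
    coset_map (relations l) g' (coset_map (relations m') e' z)"
  unfolding coset_map_comp [OF assms(1-3)] coset_map_comp [OF assms(1,4,5)]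
  using assms(1) chain_hom_comp [OF assms(2,3)] chain_hom_comp [OF assms(4,5)] assms(6)
  by (rule chain_hom_eqI)

section \<open>Scalars, cofaces and codegeneracies as maps on words\<close>

definition on_X :: "('x \<Rightarrow> 'x) \<Rightarrow> 't list \<times> 'x \<Rightarrow> ('t list \<times> 'x \<Rightarrow>\<^sub>0 int)" where
  "on_X F = (\<lambda>g. frag_of ((\<lambda>(ts, x). (ts, F x)) g))"

definition on_list :: "('t list \<Rightarrow> 't list) \<Rightarrow> 't list \<times> 'x \<Rightarrow> ('t list \<times> 'x \<Rightarrow>\<^sub>0 int)" where
  "on_list F = (\<lambda>g. frag_of ((\<lambda>(ts, x). (F ts, x)) g))"

lemma on_X_apply [simp]: "on_X F (ts, x) = frag_of (ts, F x)"
  by (simp add: on_X_def)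

lemma on_list_apply [simp]: "on_list F (ts, x) = frag_of (F ts, x)"
  by (simp add: on_list_def)

lemma scalar_eq: "scalar n c = coset_map (relations n) (on_X (sX c))"
  by (simp add: cyc_scl_def quot_map_eq_coset_map on_X_def)

lemma coface_eq: "coface n k = coset_map (relations n) (on_list (insert_one k))"
  by (simp add: cyc_coface_def quot_map_eq_coset_map on_list_def insert_one_def)

lemma codegen_eq: "codegen n k = coset_map (relations n) (on_list (merge_at k))"
  by (simp add: cyc_codegen_def quot_map_eq_coset_map on_list_def merge_at_def)

text \<open>Scaling \<open>x\<close> commutes with both actions of R on X, so each relator goes to a
  relator of the same type.\<close>

lemma chain_hom_scalar: "chain_hom n n (on_X (sX c))"
  unfolding chain_hom_def
proof (intro conjI compatible_cyc_relI)
  show "on_X (sX c) (us @ [a * \<phi> r], x) - on_X (sX c) (us @ [a], lX r x) \<in> relations n"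
    if "length us = n" for us a r x
    using rel_balanced_X [OF that] by (simp flip: L.act_scl_right)
  show "on_X (sX c) ((\<phi> r * t) # ts, x) - on_X (sX c) (t # ts, rX x r) \<in> relations n"
    if "length ts = n" for r t ts x
    using rel_cyclic [OF that] by (simp flip: R.act_scl_left)
qed (simp_all add: rel_add rel_add_X rel_balanced L.V.scl_add_right)

text \<open>An element of R passes the new unit in two steps: a relator across the insertion point
  becomes the sum of two relators, one on either side of the unit. Elsewhere relators go to
  relators.\<close>

lemma chain_hom_insert_one:
  assumes "k \<le> Suc n"
  shows "chain_hom n (Suc n) (on_list (insert_one k))"
  unfolding chain_hom_def
proof (intro conjI compatible_cyc_relI)
  show "on_list (insert_one k) (us @ (a + b) # vs, x) - on_list (insert_one k) (us @ a # vs, x) -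
      on_list (insert_one k) (us @ b # vs, x) \<in> relations (Suc n)"
    if "length us + length vs = n" for us a b vs x
  proof (cases "k \<le> length us")
    case True
    with that show ?thesis
      by (simp add: insert_one_append rel_add)
  next
    case False
    then obtain j where "k - length us = Suc j" by (cases "k - length us") auto
    with that False show ?thesis
      by (simp add: insert_one_append rel_add)
  qed
  show "on_list (insert_one k) (us @ (a * \<phi> r) # b # vs, x) -
      on_list (insert_one k) (us @ a # (\<phi> r * b) # vs, x) \<in> relations (Suc n)"
    if "Suc (length us + length vs) = n" for us a r b vs x
  proof -
    consider "k \<le> length us" | "k - length us = Suc 0" "\<not> k \<le> length us"
      | j where "k - length us = Suc (Suc j)" "\<not> k \<le> length us"
      by (cases "k - length us"; cases "k - length us - 1") auto
    then show ?thesis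
    proof cases
      case 1
      with that show ?thesis
        by (simp add: insert_one_append rel_balanced)
    next
      \<comment> \<open>The unit falls between \<open>a\<close> and \<open>b\<close>:
        \<open>r\<close> is first absorbed into it and then handed on to \<open>b\<close>.\<close>
      case 2
      have "frag_of (us @ (a * \<phi> r) # 1 # b # vs, x) - frag_of (us @ a # \<phi> r # b # vs, x)
          \<in> relations (Suc n)"
        using rel_balanced [of us "b # vs" "Suc n" a r 1 x] that by simp
      moreover have "frag_of (us @ a # \<phi> r # b # vs, x) - frag_of (us @ a # 1 # (\<phi> r * b) # vs, x)
          \<in> relations (Suc n)"
        using rel_balanced [of "us @ [a]" vs "Suc n" 1 r b x] that by simp
      ultimately show ?thesis
        using 2 by (simp add: insert_one_append)
          (blast intro: add_subgroup_cong_trans add_subgroup_cyc_rel)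
    next
      case 3
      with that show ?thesis
        by (simp add: insert_one_append rel_balanced)
    qed
  qed
  show "on_list (insert_one k) (us @ [a * \<phi> r], x) - on_list (insert_one k) (us @ [a], lX r x)
      \<in> relations (Suc n)"
    if "length us = n" for us a r x
  proof (cases "k \<le> n")
    case True
    with that show ?thesis
      by (simp add: insert_one_append rel_balanced_X)
  next
    \<comment> \<open>Here \<open>k = n + 1\<close>, so the unit stands last and hands
      \<open>r\<close> on to \<open>x\<close>.\<close>
    case False
    have "frag_of (us @ [a * \<phi> r, 1], x) - frag_of (us @ [a, \<phi> r], x) \<in> relations (Suc n)"
      using rel_balanced [of us "[]" "Suc n" a r 1 x] that by simp
    moreover have "frag_of (us @ [a, \<phi> r], x) - frag_of (us @ [a, 1], lX r x) \<in> relations (Suc n)"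
      using rel_balanced_X [of "us @ [a]" "Suc n" 1 r x] that by simp
    moreover have "k - length us = Suc 0"
      using False assms that by simp
    ultimately show ?thesis
      using False that by (simp add: insert_one_append)
        (blast intro: add_subgroup_cong_trans add_subgroup_cyc_rel)
  qed
  show "on_list (insert_one k) ((\<phi> r * t) # ts, x) - on_list (insert_one k) (t # ts, rX x r)
      \<in> relations (Suc n)"
    if "length ts = n" for r t ts x
  proof (cases k)
    \<comment> \<open>The unit stands in front: it takes over \<open>r\<close> from \<open>t\<close>
      by balancing, and the cyclic relation carries \<open>r\<close> around to
      \<open>x\<close>.\<close>
    case 0
    have "frag_of ([1, \<phi> r * t] @ ts, x) - frag_of ([\<phi> r, t] @ ts, x) \<in> relations (Suc n)"
      using add_subgroup_cong_sym [OF add_subgroup_cyc_rel rel_balanced [of "[]" ts "Suc n" 1 r t x]]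
        that by simp
    moreover have "frag_of ([\<phi> r, t] @ ts, x) - frag_of ([1, t] @ ts, rX x r) \<in> relations (Suc n)"
      using rel_cyclic [of "t # ts" "Suc n" r 1 x] that by simp
    ultimately show ?thesis
      using 0 by simp (blast intro: add_subgroup_cong_trans add_subgroup_cyc_rel)
  next
    case (Suc j)
    with that show ?thesis
      by (simp add: rel_cyclic)
  qed
qed (simp_all add: rel_add_X)

text \<open>The case splits locate the merged pair relative to the letters changed by the relator.
  Away from them the relator keeps its type; if the pair meets them, distributivity or associativity
  of T restores a relator, and merging the balanced pair itself gives equal words.\<close>

lemma chain_hom_merge_at:
  assumes "k \<le> n"
  shows "chain_hom (Suc n) n (on_list (merge_at k))"
  unfolding chain_hom_def
proof (intro conjI compatible_cyc_relI)
  show "on_list (merge_at k) (us @ (a + b) # vs, x) - on_list (merge_at k) (us @ a # vs, x) -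
      on_list (merge_at k) (us @ b # vs, x) \<in> relations n"
    if "length us + length vs = Suc n" for us a b vs x
  proof -
    consider "Suc k < length us" | "Suc k = length us" | "k = length us"
      | j where "k - length us = Suc j" "length us \<le> k"
      by (cases "k - length us") fastforce+
    then show ?thesis
    proof cases
      case 1
      with that show ?thesis
        by (simp add: merge_at_append_left rel_add)
    next
      case 2
      with that show ?thesis
        by (simp add: merge_at_append_last rel_add distrib_left)
    next
      case 3
      with that assms obtain v vs' where "vs = v # vs'" by (cases vs) auto
      with 3 that show ?thesis
        by (simp add: merge_at_append_right rel_add distrib_right)
    next
      case 4
      with that assms show ?thesis
        by (simp add: merge_at_append_right rel_add)
    qed
  qed
  show "on_list (merge_at k) (us @ (a * \<phi> r) # b # vs, x) -
      on_list (merge_at k) (us @ a # (\<phi> r * b) # vs, x) \<in> relations n"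
    if "Suc (length us + length vs) = Suc n" for us a r b vs x
  proof -
    consider "Suc k < length us" | "Suc k = length us" | "k = length us"
      | "k - length us = Suc 0" "length us \<le> k"
      | j where "k - length us = Suc (Suc j)" "length us \<le> k"
      by (cases "k - length us"; cases "k - length us - 1") fastforce+
    then show ?thesis
    proof cases
      case 1
      with that show ?thesis
        by (simp add: merge_at_append_left rel_balanced)
    next
      case 2
      with that show ?thesis
        using rel_balanced [of "butlast us" vs n "last us * a" r b x]
        by (simp add: merge_at_append_last mult.assoc)
    next
      case 3
      then show ?thesis
        by (simp add: merge_at_append_right mult.assoc add_subgroup_zero)
    next
      case 4
      with that assms obtain v vs' where "vs = v # vs'" by (cases vs) auto
      with 4 that show ?thesis
        by (simp add: merge_at_append_right mult.assoc rel_balanced)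
    next
      case 5
      with that assms show ?thesis
        by (simp add: merge_at_append_right rel_balanced)
    qed
  qed
  show "on_list (merge_at k) (us @ [a * \<phi> r], x) - on_list (merge_at k) (us @ [a], lX r x)
      \<in> relations n"
    if "length us = Suc n" for us a r x
  proof (cases "k = n")
    case True
    with that show ?thesis
      using rel_balanced_X [of "butlast us" n "last us * a" r x]
      by (simp add: merge_at_append_last mult.assoc)
  next
    case False
    with that assms show ?thesis
      by (simp add: merge_at_append_left rel_balanced_X)
  qed
  show "on_list (merge_at k) ((\<phi> r * t) # ts, x) - on_list (merge_at k) (t # ts, rX x r)
      \<in> relations n"
    if "length ts = Suc n" for r t ts x
  proof (cases k)
    case 0
    from that obtain t' ts' where "ts = t' # ts'" by (cases ts) auto
    with 0 that show ?thesis
      by (simp add: mult.assoc rel_cyclic)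
  next
    case (Suc j)
    with that assms show ?thesis
      by (simp add: rel_cyclic)
  qed
qed (use assms in \<open>simp_all add: rel_add_X\<close>)

section \<open>Linearity, module axioms and cosimplicial identities\<close>

lemma k_linear_coset_map:
  assumes e: "chain_hom n m e"
    and "\<And>c ts x. length ts = Suc n \<Longrightarrow>
      e (ts, sX c x) - frag_extend (on_X (sX c)) (e (ts, x)) \<in> relations m"
  shows "k_linear (chains n) (scalar n) (chains m) (scalar m) (coset_map (relations m) e)"
  unfolding k_linear_def
proof (intro conjI ballI allI)
  show "coset_map (relations m) e z \<in> chains m" if "z \<in> chains n" for z
    using coset_map_closed [OF e that] .
  show "coset_map (relations m) e (z + z') = coset_map (relations m) e z + coset_map (relations m) e z'"
    if "z \<in> chains n" "z' \<in> chains n" for z z'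
    using that by (auto elim!: chains_cases simp: coset_plus chain_hom_coset [OF e] frag_extend_add)
  show "coset_map (relations m) e (scalar n c z) = scalar m c (coset_map (relations m) e z)"
    if "z \<in> chains n" for c z
    unfolding scalar_eq
    by (rule comp_eqI [OF that chain_hom_scalar e e chain_hom_scalar]) (simp add: assms)
qed

lemma k_module_chains: "k_module_on (chains n) (relations n) (scalar n)"
proof
  show "relations n \<in> chains n"
    using chainsI [of 0 n] by (simp add: add_subgroup_zero)
  show "z + z' \<in> chains n" if "z \<in> chains n" "z' \<in> chains n" for z z'
    using that by (auto elim!: chains_cases simp: coset_plus add_subgroup_add intro!: chainsI)
  show "scalar n c z \<in> chains n" if "z \<in> chains n" for c z
    using coset_map_closed [OF chain_hom_scalar that] by (simp add: scalar_eq)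
  show "relations n + z = z" if "z \<in> chains n" for z
    using that coset_plus [of "relations n" 0] by (auto elim!: chains_cases)
  show "\<exists>z'\<in>chains n. z + z' = relations n" if "z \<in> chains n" for z
    using that
  proof (rule chains_cases)
    fix f assume "f \<in> chain_free n" and z: "z = f +o relations n"
    then have "(- f) +o relations n \<in> chains n"
      by (intro chainsI) (simp add: add_subgroup_minus)
    moreover have "z + ((- f) +o relations n) = relations n"
      by (simp add: z coset_plus)
    ultimately show ?thesis by blast
  qed
  show "scalar n c (z + z') = scalar n c z + scalar n c z'"
    if "z \<in> chains n" "z' \<in> chains n" for c z z'
    using that
    by (auto elim!: chains_cases simp: scalar_eq coset_plus chain_hom_coset [OF chain_hom_scalar]
        frag_extend_add)
  \<comment> \<open>Scalars act on the last slot, so additivity in the scalar is the additivity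
    relator in \<open>x\<close>.\<close>
  show "scalar n (c + c') z = scalar n c z + scalar n c' z" if "z \<in> chains n" for c c' z
    using that
  proof (rule chains_cases)
    fix f assume "f \<in> chain_free n" and z: "z = f +o relations n"
    then have "frag_extend (on_X (sX (c + c'))) f - frag_extend (on_X (sX c)) f -
        frag_extend (on_X (sX c')) f \<in> relations n"
      by (intro frag_extend_additive_mem)
        (auto simp: chain_free_def L.V.scl_add_left intro!: rel_add_X)
    then show ?thesis
      by (simp add: z scalar_eq coset_plus chain_hom_coset [OF chain_hom_scalar] coset_eq_iff
          diff_diff_eq)
  qed
  show "scalar n c (scalar n c' z) = scalar n (c * c') z" if "z \<in> chains n" for c c' z
    unfolding scalar_eq coset_map_comp [OF that chain_hom_scalar chain_hom_scalar]
    by (rule chain_hom_eqI [OF that chain_hom_comp [OF chain_hom_scalar chain_hom_scalar]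
          chain_hom_scalar])
      (simp add: L.V.scl_scl add_subgroup_zero)
  show "scalar n 1 z = z" if "z \<in> chains n" for z
  proof -
    have "on_X (sX 1) = frag_of"
      by (simp add: fun_eq_iff L.V.scl_one)
    with that show ?thesis
      by (simp add: scalar_eq coset_map_frag_of)
  qed
qed

lemma cosimplicial_chains: "cosimplicial_module chains relations scalar coface codegen"
proof (rule cosimplicial_module.intro)
  show "k_module_on (chains n) (relations n) (scalar n)" for n
    by (rule k_module_chains)
  show "k_linear (chains n) (scalar n) (chains (Suc n)) (scalar (Suc n)) (coface (Suc n) k)"
    if "k \<le> Suc n" for k n
    unfolding coface_eq
    by (rule k_linear_coset_map [OF chain_hom_insert_one [OF that]]) (simp add: add_subgroup_zero)
  show "k_linear (chains (Suc n)) (scalar (Suc n)) (chains n) (scalar n) (codegen n k)"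
    if "k \<le> n" for k n
    unfolding codegen_eq
    by (rule k_linear_coset_map [OF chain_hom_merge_at [OF that]]) (simp add: add_subgroup_zero)
  show "coface (n + 2) j (coface (n + 1) i z) = coface (n + 2) i (coface (n + 1) (j - 1) z)"
    if "i < j" "j \<le> n + 2" "z \<in> chains n" for i j n z
    unfolding coface_eq
    by (rule comp_eqI [OF that(3)])
      (use that chain_hom_insert_one [of _ n] chain_hom_insert_one [of _ "Suc n"] in
        \<open>simp_all add: insert_one_insert_one add_subgroup_zero\<close>)
  show "codegen n j (codegen (n + 1) i z) = codegen n i (codegen (n + 1) (j + 1) z)"
    if "i \<le> j" "j \<le> n" "z \<in> chains (n + 2)" for i j n z
    unfolding codegen_eq
    by (rule comp_eqI [OF that(3)])
      (use that chain_hom_merge_at [of _ n] chain_hom_merge_at [of _ "Suc n"] in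
        \<open>simp_all add: merge_at_merge_at add_subgroup_zero\<close>)
  show "codegen n j (coface (n + 1) i z) = coface n i (codegen (n - 1) (j - 1) z)"
    if "i < j" "j \<le> n" "z \<in> chains n" for i j n z
  proof -
    \<comment> \<open>The hypotheses force \<open>n \<ge> 1\<close>, so \<open>n - 1\<close> is a
      true predecessor.\<close>
    from that obtain n' where n: "n = Suc n'" by (cases n) auto
    show ?thesis
      unfolding codegen_eq coface_eq
      by (rule comp_eqI [OF that(3)])
        (use that chain_hom_merge_at [of _ n] chain_hom_insert_one [of _ n]
          chain_hom_merge_at [of _ n'] chain_hom_insert_one [of _ n'] in
          \<open>simp_all add: n merge_at_insert_one_less add_subgroup_zero\<close>)
  qed
  show "codegen n j (coface (n + 1) i z) = z"
    if "i = j \<or> i = j + 1" "j \<le> n" "z \<in> chains n" for i j n z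
  proof -
    have hom: "chain_hom n (n + 1) (on_list (insert_one i))" "chain_hom (n + 1) n (on_list (merge_at j))"
      using that chain_hom_merge_at [of j n] chain_hom_insert_one [of i n] by auto
    \<comment> \<open>The identity is the map induced by \<open>frag_of\<close>, so this too is a
      comparison on words.\<close>
    have "codegen n j (coface (n + 1) i z) = coset_map (relations n) frag_of z"
      unfolding codegen_eq coface_eq coset_map_comp [OF that(3) hom]
      by (rule chain_hom_eqI [OF that(3) chain_hom_comp [OF hom] chain_hom_frag_of])
        (use that in \<open>simp add: merge_at_insert_one_id add_subgroup_zero\<close>)
    also have "\<dots> = z"
      using that(3) by (rule coset_map_frag_of)
    finally show ?thesis .
  qed
  show "codegen n j (coface (n + 1) i z) = coface n (i - 1) (codegen (n - 1) j z)"
    if "j + 1 < i" "i \<le> n + 1" "z \<in> chains n" for i j n z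
  proof -
    from that obtain n' where n: "n = Suc n'" by (cases n) auto
    show ?thesis
      unfolding codegen_eq coface_eq
      by (rule comp_eqI [OF that(3)])
        (use that chain_hom_merge_at [of _ n] chain_hom_insert_one [of _ n]
          chain_hom_merge_at [of _ n'] chain_hom_insert_one [of _ n'] in
          \<open>simp_all add: n merge_at_insert_one_greater add_subgroup_zero\<close>)
  qed
qed

end


section \<open>The coaction of a comodule algebra\<close>

text \<open>
  Balancedness of the multiplication at \<open>1 \<cdot> 1\<close> yields \<open>r \<cdot> 1 = 1 \<cdot> r\<close>. The axiom \<open>coact_mult\<close> holds
  for all representatives of \<open>\<rho> 1\<close>, in particular for \<open>1 \<cdot> r \<otimes> 1 - 1 \<otimes> \<zeta>(r) + 1 \<otimes> 1\<close>, and this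
  yields the Takeuchi property \<open>r \<cdot> t\<^sup>0 \<otimes> t\<^sup>1 = t\<^sup>0 \<otimes> \<zeta>(r) t\<^sup>1\<close>.
\<close>

locale comodule_algebra_module =
  right_comodule_algebra sR sB \<xi> \<zeta> \<Delta> \<epsilon> sT rT \<rho> + X: right_module sB sX act
  for sR :: "'k::{comm_ring,comm_monoid_mult} \<Rightarrow> 'r::{ring,monoid_mult} \<Rightarrow> 'r"
    and sB :: "'k \<Rightarrow> 'b::{ring,monoid_mult} \<Rightarrow> 'b"
    and \<xi> :: "'r \<Rightarrow> 'b" and \<zeta> :: "'r \<Rightarrow> 'b"
    and \<Delta> :: "'b \<Rightarrow> ('b \<times> 'b \<Rightarrow>\<^sub>0 int) set" and \<epsilon> :: "'b \<Rightarrow> 'r"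
    and sT :: "'k \<Rightarrow> 't::{ring,monoid_mult} \<Rightarrow> 't" and rT :: "'t \<Rightarrow> 'r \<Rightarrow> 't"
    and \<rho> :: "'t \<Rightarrow> ('t \<times> 'b \<Rightarrow>\<^sub>0 int) set"
    and sX :: "'k \<Rightarrow> 'x::ab_group_add \<Rightarrow> 'x" and act :: "'x \<Rightarrow> 'b \<Rightarrow> 'x"
begin

section \<open>The actions of R on T and X\<close>

definition unit_map :: "'r \<Rightarrow> 't" where
  "unit_map r = rT 1 r"

abbreviation left_X :: "'r \<Rightarrow> 'x \<Rightarrow> 'x" where
  "left_X \<equiv> \<lambda>r x. act x (\<zeta> r)"

abbreviation right_X :: "'x \<Rightarrow> 'r \<Rightarrow> 'x" where
  "right_X \<equiv> \<lambda>x r. act x (\<xi> r)"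

abbreviation TB_rel :: "('t \<times> 'b \<Rightarrow>\<^sub>0 int) set" where
  "TB_rel \<equiv> tensor2_rel rT (base_left \<zeta>)"

lemma comodule_left_one: "comodule_left \<xi> \<epsilon> rT \<rho> r 1 = unit_map r"
  using mult_balanced [of 1 r 1] by (simp add: unit_map_def)

text \<open>Balancedness with second factor 1; the given right action is thus the one of an
  R-ring.\<close>

lemma rT_eq: "rT t r = t * unit_map r"
  using mult_balanced [of t r 1] by (simp add: comodule_left_one)

text \<open>Balancedness with first factor 1; it removes the coaction from the formula for the left
  action.\<close>

lemma comodule_left_eq: "comodule_left \<xi> \<epsilon> rT \<rho> r t = unit_map r * t"
  using mult_balanced [of 1 r t] by (simp add: unit_map_def)

text \<open>Multiplicativity is the module law \<open>1 (r r') = (1 r) r'\<close>, read through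
  \<open>rT_eq\<close>.\<close>

lemma unit_map_hom: "k_algebra_hom sR sT unit_map"
  unfolding k_algebra_hom_def k_linear_def
  by (simp add: unit_map_def act_add_right act_scl_right act_one act_mult)
    (simp add: rT_eq flip: unit_map_def)

lemma source_one: "\<xi> 1 = 1" and source_mult: "\<xi> (r * r') = \<xi> r * \<xi> r'"
  and source_add: "\<xi> (r + r') = \<xi> r + \<xi> r'" and source_scl: "\<xi> (sR c r) = sB c (\<xi> r)"
  using bialg.source_hom by (simp_all add: k_algebra_hom_def k_linear_def)

lemma target_one: "\<zeta> 1 = 1" and target_mult: "\<zeta> (r * r') = \<zeta> r' * \<zeta> r"
  and target_add: "\<zeta> (r + r') = \<zeta> r + \<zeta> r'" and target_scl: "\<zeta> (sR c r) = sB c (\<zeta> r)"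
  using bialg.target_hom by (simp_all add: k_algebra_antihom_def k_linear_def)

text \<open>\<open>\<zeta>\<close> reverses products, which turns the right action of B into a left
  action of R; the two actions commute because the ranges of \<open>\<xi>\<close> and
  \<open>\<zeta>\<close> do.\<close>

lemma bimodule_X: "bimodule sR sX left_X right_X"
proof unfold_locales
  show "act (act x (\<zeta> r)) (\<xi> r') = act (act x (\<xi> r')) (\<zeta> r)" for r r' x
    by (simp add: bialg.ranges_commute flip: X.act_mult)
qed (simp_all add: X.act_add_left X.act_add_right X.act_scl_left X.act_scl_right X.act_one
    X.act_mult source_one source_mult source_add source_scl target_one target_mult target_add
    target_scl)

section \<open>Chosen representatives of the coaction and their laws\<close>

definition coact_rep :: "'t \<Rightarrow> ('t \<times> 'b \<Rightarrow>\<^sub>0 int)" where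
  "coact_rep t = (SOME f. f \<in> \<rho> t)"

text \<open>A value of \<open>\<rho>\<close> is a priori any set of formal sums; linearity of the
  coaction places it in the tensor product.\<close>

lemma coaction_is_coset: obtains g where "\<rho> t = g +o TB_rel"
proof -
  have "\<rho> t \<in> tensor2 rT (base_left \<zeta>)"
    using coact_linear by (simp add: k_linear_def)
  with that show ?thesis
    unfolding tensor2_def by blast
qed

lemma coaction_eq: "f \<in> \<rho> t \<Longrightarrow> \<rho> t = f +o TB_rel"
  by (metis add_subgroup_tensor2_rel coaction_is_coset coset_rep_eq)

lemma coact_rep_mem: "coact_rep t \<in> \<rho> t"
proof -
  obtain g where "\<rho> t = g +o TB_rel"
    by (rule coaction_is_coset)
  then have "g \<in> \<rho> t"
    by (simp add: mem_own_coset)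
  then show ?thesis
    unfolding coact_rep_def by (rule someI)
qed

lemma coaction_coset: "\<rho> t = coact_rep t +o TB_rel"
  by (rule coaction_eq [OF coact_rep_mem])

text \<open>Reduces each law for the chosen representatives to exhibiting some representative of the
  coaction in question.\<close>

lemma coact_rep_cong: "f \<in> \<rho> t \<Longrightarrow> coact_rep t - f \<in> TB_rel"
  using coact_rep_mem coaction_eq set_plus_imp_minus by metis

lemma coact_rep_add: "coact_rep (t + t') - (coact_rep t + coact_rep t') \<in> TB_rel"
proof -
  have "\<rho> (t + t') = \<rho> t + \<rho> t'"
    using coact_linear by (simp add: k_linear_def)
  also have "\<dots> = (coact_rep t + coact_rep t') +o TB_rel"
    by (simp add: coaction_coset [of t] coaction_coset [of t'] coset_plus)
  finally show ?thesis
    by (intro coact_rep_cong) (simp add: mem_own_coset)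
qed

lemma coact_rep_one: "coact_rep 1 - frag_of (1, 1) \<in> TB_rel"
  by (intro coact_rep_cong) (simp add: coact_one mem_own_coset)

lemma coact_rep_mult:
  "coact_rep (t * t') - componentwise_mult (coact_rep t) (coact_rep t') \<in> TB_rel"
  by (intro coact_rep_cong) (simp add: coact_mult [OF coact_rep_mem coact_rep_mem] mem_own_coset)

text \<open>That \<open>b \<mapsto> b * \<xi> r\<close> descends to the tensor product uses that the
  ranges of \<open>\<xi>\<close> and \<open>\<zeta>\<close> commute. An arbitrary representative
  \<open>f\<close> is allowed so that \<open>coact_one\<close> can be inserted.\<close>

lemma coaction_rT:
  assumes "\<rho> t = f +o TB_rel"
  shows "\<rho> (rT t r) = frag_extend (\<lambda>(u, b). frag_of (u, b * \<xi> r)) f +o TB_rel"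
proof -
  have "compatible TB_rel (\<lambda>(u, b). frag_of (u, b * \<xi> r)) TB_rel"
  proof (rule compatible_tensor2I)
    show "(case (rT u r', b) of (u, b) \<Rightarrow> frag_of (u, b * \<xi> r)) -
        (case (u, b * \<zeta> r') of (u, b) \<Rightarrow> frag_of (u, b * \<xi> r)) \<in> TB_rel" for u r' b
      using tensor2_rel_balanced [of rT u r' "b * \<xi> r" "base_left \<zeta>"]
      by (simp add: mult.assoc bialg.ranges_commute)
  qed (simp_all add: distrib_right tensor2_rel_intros)
  from quot_map_coset [OF _ _ this [unfolded case_prod_unfold]] show ?thesis
    by (simp add: coact_right assms tensor2_right_def case_prod_unfold)
qed

lemma coact_rep_right:
  "coact_rep (t * unit_map r) - frag_extend (\<lambda>(u, b). frag_of (u, b * \<xi> r)) (coact_rep t)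
   \<in> TB_rel"
  using coaction_rT [OF coaction_coset, of t r]
  by (intro coact_rep_cong) (simp add: rT_eq mem_own_coset)

text \<open>Right linearity at 1 gives \<open>1 \<otimes> \<xi>(r)\<close> as the coaction of
  \<open>unit_map r\<close>; multiplicativity then puts \<open>\<xi>(r)\<close> to the left of the
  B-component.\<close>

lemma coact_rep_left:
  "coact_rep (unit_map r * t) - frag_extend (\<lambda>(u, b). frag_of (u, \<xi> r * b)) (coact_rep t)
   \<in> TB_rel"
proof (rule coact_rep_cong)
  have "\<rho> (unit_map r) = frag_of (1, \<xi> r) +o TB_rel"
    using coaction_rT [OF coact_one, of r] by (simp add: unit_map_def)
  then have "frag_of (1, \<xi> r) \<in> \<rho> (unit_map r)"
    by (simp add: mem_own_coset)
  from coact_mult [OF this coact_rep_mem]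
  show "frag_extend (\<lambda>(u, b). frag_of (u, \<xi> r * b)) (coact_rep t) \<in> \<rho> (unit_map r * t)"
    by (simp add: componentwise_mult_def mem_own_coset)
qed

lemma coact_rep_takeuchi:
  "frag_extend (\<lambda>(u, b). frag_of (unit_map r * u, b)) (coact_rep t) -
   frag_extend (\<lambda>(u, b). frag_of (u, \<zeta> r * b)) (coact_rep t) \<in> TB_rel"
    (is "?f - ?g \<in> _")
proof -
  let ?e = "frag_of (1, 1) + (frag_of (rT 1 r, 1) - frag_of (1, \<zeta> r)) :: 't \<times> 'b \<Rightarrow>\<^sub>0 int"
  have "frag_of (rT 1 r, 1) - frag_of (1, \<zeta> r) \<in> TB_rel"
    using tensor2_rel_balanced [of rT 1 r 1 "base_left \<zeta>"] by simp
  then have "?e \<in> \<rho> 1"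
    unfolding coact_one by (rule set_plus_intro2)
  \<comment> \<open>As \<open>1 * t = t\<close>, the product of \<open>?e\<close> with
    \<open>coact_rep t\<close> and \<open>coact_rep t\<close> itself represent the same coaction, so
    their difference \<open>?f - ?g\<close> lies in \<open>TB_rel\<close>.\<close>
  from coact_mult [OF this coact_rep_mem, of t]
  have "\<rho> t = componentwise_mult ?e (coact_rep t) +o TB_rel"
    by simp
  also have "componentwise_mult ?e (coact_rep t) = coact_rep t + (?f - ?g)"
    by (simp add: componentwise_mult_def frag_extend_add frag_extend_diff unit_map_def
        case_prod_unfold)
  finally have "coact_rep t + (?f - ?g) - coact_rep t \<in> TB_rel"
    using coset_eq_iff [OF add_subgroup_tensor2_rel] coaction_coset by metis
  then show ?thesis
    by simp
qed

section \<open>Coaction laws pushed forward along maps out of the tensor product of T and B\<close>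

context
  fixes h :: "'t \<times> 'b \<Rightarrow> ('g \<Rightarrow>\<^sub>0 int)" and N
  assumes N: "add_subgroup N" and h: "compatible TB_rel h N"
begin

lemma extend_coact_cong:
  "f \<in> \<rho> t \<Longrightarrow> frag_extend h (coact_rep t) - frag_extend h f \<in> N"
  using compatibleD [OF h coact_rep_cong] by (simp add: frag_extend_diff)

lemma extend_coact_add:
  "frag_extend h (coact_rep (t + t')) - frag_extend h (coact_rep t) -
   frag_extend h (coact_rep t') \<in> N"
  using compatibleD [OF h coact_rep_add]
  by (simp add: frag_extend_diff frag_extend_add diff_diff_eq)

lemma extend_coact_one: "frag_extend h (coact_rep 1) - h (1, 1) \<in> N"
  using compatibleD [OF h coact_rep_one] by (simp add: frag_extend_diff)

lemma extend_coact_mult: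
  "frag_extend h (coact_rep (t * t')) -
   frag_extend (\<lambda>(u, b). frag_extend (\<lambda>(u', b'). h (u * u', b * b')) (coact_rep t'))
     (coact_rep t) \<in> N"
  using compatibleD [OF h coact_rep_mult]
  by (simp add: frag_extend_diff frag_extend_frag_extend componentwise_mult_def case_prod_unfold)

lemma extend_coact_right:
  "frag_extend h (coact_rep (t * unit_map r)) -
   frag_extend (\<lambda>(u, b). h (u, b * \<xi> r)) (coact_rep t) \<in> N"
  using compatibleD [OF h coact_rep_right]
  by (simp add: frag_extend_diff frag_extend_frag_extend case_prod_unfold)

lemma extend_coact_left:
  "frag_extend h (coact_rep (unit_map r * t)) -
   frag_extend (\<lambda>(u, b). h (u, \<xi> r * b)) (coact_rep t) \<in> N"
  using compatibleD [OF h coact_rep_left]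
  by (simp add: frag_extend_diff frag_extend_frag_extend case_prod_unfold)

lemma extend_coact_takeuchi:
  "frag_extend (\<lambda>(u, b). h (unit_map r * u, b)) (coact_rep t) -
   frag_extend (\<lambda>(u, b). h (u, \<zeta> r * b)) (coact_rep t) \<in> N"
  using compatibleD [OF h coact_rep_takeuchi]
  by (simp add: frag_extend_diff frag_extend_frag_extend case_prod_unfold)

end


subsection \<open>The transposition map\<close>

abbreviation TX_rel :: "('t \<times> 'x \<Rightarrow>\<^sub>0 int) set" where
  "TX_rel \<equiv> tensor2_rel (ring_right unit_map) left_X"

abbreviation XT_rel :: "('x \<times> 't \<Rightarrow>\<^sub>0 int) set" where
  "XT_rel \<equiv> tensor2_rel right_X (ring_left unit_map)"

lemma TX_balanced: "frag_of (t * unit_map r, x) - frag_of (t, act x (\<zeta> r)) \<in> TX_rel"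
  using tensor2_rel_balanced [where rM = "ring_right unit_map" and lP = left_X] .

lemma XT_balanced: "frag_of (act x (\<xi> r), t) - frag_of (x, unit_map r * t) \<in> XT_rel"
  using tensor2_rel_balanced [where rM = right_X and lP = "ring_left unit_map"] .

text \<open>A lift of the transposition map to formal sums; it is built from the chosen
  representatives, and its class modulo \<open>TX_rel\<close> does not depend on them.\<close>

definition twist :: "'x \<times> 't \<Rightarrow> ('t \<times> 'x \<Rightarrow>\<^sub>0 int)" where
  "twist = (\<lambda>(x, t). frag_extend (\<lambda>(u, b). frag_of (u, act x b)) (coact_rep t))"

text \<open>On X the factor \<open>\<zeta> r\<close> of \<open>b * \<zeta> r\<close> is the left
  action of R, which balancing turns into \<open>unit_map r\<close> on the T-component.\<close>

lemma compatible_act: "compatible TB_rel (\<lambda>(u, b). frag_of (u, act x b)) TX_rel"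
proof (rule compatible_tensor2I)
  show "(case (rT u r, b) of (u, b) \<Rightarrow> frag_of (u, act x b)) -
      (case (u, b * \<zeta> r) of (u, b) \<Rightarrow> frag_of (u, act x b)) \<in> TX_rel" for u r b
    by (simp add: rT_eq X.act_mult TX_balanced)
qed (simp_all add: X.act_add_right tensor2_rel_intros)

text \<open>Independence of the chosen representative; it yields the formula for the transposition
  in every Sweedler notation of the coaction.\<close>

lemma twist_coaction:
  "f \<in> \<rho> t \<Longrightarrow> twist (x, t) - frag_extend (\<lambda>(u, b). frag_of (u, act x b)) f \<in> TX_rel"
  unfolding twist_def using extend_coact_cong [OF _ compatible_act] by simp

lemma twist_add_left: "twist (x + x', t) - twist (x, t) - twist (x', t) \<in> TX_rel"
  unfolding twist_def prod.case
  by (rule frag_extend_additive_mem) (auto simp: X.act_add_left tensor2_rel_intros)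

lemma twist_add_right: "twist (x, t + t') - twist (x, t) - twist (x, t') \<in> TX_rel"
  unfolding twist_def using extend_coact_add [OF _ compatible_act] by simp

text \<open>The action law moves \<open>\<xi> r\<close> in front of the B-component, where
  \<open>extend_coact_left\<close> recognises the coaction of \<open>unit_map r * t\<close>.\<close>

lemma twist_balanced: "twist (right_X x r, t) - twist (x, unit_map r * t) \<in> TX_rel"
proof -
  have "twist (x, unit_map r * t) - twist (right_X x r, t) \<in> TX_rel"
    unfolding twist_def using extend_coact_left [OF _ compatible_act] by (simp add: X.act_mult)
  then show ?thesis
    by (rule add_subgroup_cong_sym [OF add_subgroup_tensor2_rel])
qed

text \<open>The Takeuchi property trades \<open>\<zeta> r\<close> in front of the B-component for
  \<open>unit_map r\<close> in front of the T-component.\<close>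

lemma twist_left:
  "twist (left_X r x, t) - frag_extend (\<lambda>(u, y). frag_of (unit_map r * u, y)) (twist (x, t)) \<in> TX_rel"
proof -
  have "frag_extend (\<lambda>(u, y). frag_of (unit_map r * u, y)) (twist (x, t)) - twist (left_X r x, t)
      \<in> TX_rel"
    using extend_coact_takeuchi [OF _ compatible_act [of x], where r = r and t = t]
    by (simp add: twist_def frag_extend_frag_extend case_prod_unfold X.act_mult)
  then show ?thesis
    by (rule add_subgroup_cong_sym [OF add_subgroup_tensor2_rel])
qed

lemma twist_right:
  "twist (x, t * unit_map r) - frag_extend (\<lambda>(u, y). frag_of (u, right_X y r)) (twist (x, t)) \<in> TX_rel"
  using extend_coact_right [OF _ compatible_act [of x], where r = r and t = t]
  by (simp add: twist_def frag_extend_frag_extend case_prod_unfold X.act_mult)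

lemma twist_one: "twist (x, 1) - frag_of (1, x) \<in> TX_rel"
  using extend_coact_one [OF _ compatible_act [of x]] by (simp add: twist_def X.act_one)

text \<open>The inner \<open>twist\<close> starts from \<open>x\<close> already acted on by the
  B-component of \<open>t\<close>; the action law then assembles the two B-components in the order
  that \<open>coact_mult\<close> requires.\<close>

lemma twist_mult:
  "twist (x, t * t') - frag_extend (\<lambda>(u, y). frag_extend (\<lambda>(u', y'). frag_of (u * u', y'))
     (twist (y, t'))) (twist (x, t)) \<in> TX_rel"
  using extend_coact_mult [OF _ compatible_act [of x], where t = t and t' = t']
  by (simp add: twist_def frag_extend_frag_extend case_prod_unfold X.act_mult)

text \<open>The ground ring acts through \<open>c 1\<close> in R, which may cross the tensor sign.
  This serves to compare scalar actions: \<open>tensor2_scl\<close> scales the first factor, which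
  is X before and T after the transposition.\<close>

lemma TX_scl: "frag_of (u, sX c y) - frag_of (sT c u, y) \<in> TX_rel"
proof -
  have "u * unit_map (sR c 1) = sT c u"
    using unit_map_hom by (simp add: k_algebra_hom_def k_linear_def T.scl_mult_right)
  moreover have "left_X (sR c 1) y = sX c y"
    by (simp add: target_scl target_one X.act_scl_right X.act_one)
  ultimately have "frag_of (sT c u, y) - frag_of (u, sX c y) \<in> TX_rel"
    using TX_balanced [of u "sR c 1" y] by simp
  then show ?thesis
    by (rule add_subgroup_cong_sym [OF add_subgroup_tensor2_rel])
qed

lemma twist_scl_X: "twist (sX c x, t) = frag_extend (\<lambda>(u, y). frag_of (u, sX c y)) (twist (x, t))"
  by (simp add: twist_def frag_extend_frag_extend case_prod_unfold X.act_scl_left)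

lemma twist_scl_T:
  "twist (sX c x, t) - frag_extend (\<lambda>(u, y). frag_of (sT c u, y)) (twist (x, t)) \<in> TX_rel"
  unfolding twist_scl_X by (rule frag_extend_cong_mem) (auto simp: TX_scl)

lemma compatible_twist: "compatible XT_rel twist TX_rel"
  by (rule compatible_tensor2I)
    (simp_all only: twist_add_left twist_add_right twist_balanced add_subgroup_tensor2_rel)

definition transposition :: "('x \<times> 't \<Rightarrow>\<^sub>0 int) set \<Rightarrow> ('t \<times> 'x \<Rightarrow>\<^sub>0 int) set" where
  "transposition = coset_map TX_rel twist"

lemma transposition_coset: "transposition (f +o XT_rel) = frag_extend twist f +o TX_rel"
  by (simp add: transposition_def coset_map_coset compatible_twist)

lemma compatible_XT_endo:
  assumes "\<And>x x'. F (x + x') = F x + F x'" "\<And>t t'. G (t + t') = G t + G t'"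
    and "\<And>x r. F (right_X x r) = right_X (F x) r"
    and "\<And>r t. G (unit_map r * t) = unit_map r * G t"
  shows "compatible XT_rel (\<lambda>g. frag_of ((\<lambda>(x, t). (F x, G t)) g)) XT_rel"
  by (rule compatible_tensor2I) (simp_all add: assms tensor2_rel_intros XT_balanced)

lemma compatible_TX_endo:
  assumes "\<And>x x'. F (x + x') = F x + F x'" "\<And>t t'. G (t + t') = G t + G t'"
    and "\<And>x r. F (left_X r x) = left_X r (F x)"
    and "\<And>r t. G (t * unit_map r) = G t * unit_map r"
  shows "compatible TX_rel (\<lambda>g. frag_of ((\<lambda>(t, x). (G t, F x)) g)) TX_rel"
  by (rule compatible_tensor2I) (simp_all add: assms tensor2_rel_intros TX_balanced)

text \<open>One argument for scalars and both actions of R: \<open>h\<close> and \<open>k\<close>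
  realize the operation on generators before and after the transposition.\<close>

lemma transposition_equivariant:
  assumes f: "z = f +o XT_rel"
    and "compatible XT_rel (\<lambda>g. frag_of (h g)) XT_rel"
    and "compatible TX_rel (\<lambda>g. frag_of (k g)) TX_rel"
    and "\<And>x t. twist (h (x, t)) - frag_extend (\<lambda>g. frag_of (k g)) (twist (x, t)) \<in> TX_rel"
  shows "transposition (quot_map XT_rel h z) = quot_map TX_rel k (transposition z)"
  by (simp add: f quot_map_coset assms transposition_coset coset_eq_iff frag_extend_frag_extend)
    (rule frag_extend_cong_mem; auto simp: assms)

lemma transposition_bimodule_map:
  "bimodule_map
    (tensor2 right_X (ring_left unit_map)) (tensor2_scl right_X (ring_left unit_map) sX)
    (tensor2_left right_X (ring_left unit_map) left_X)
    (tensor2_right right_X (ring_left unit_map) (ring_right unit_map))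
    (tensor2 (ring_right unit_map) left_X) (tensor2_scl (ring_right unit_map) left_X sT)
    (tensor2_left (ring_right unit_map) left_X (ring_left unit_map))
    (tensor2_right (ring_right unit_map) left_X right_X) transposition"
  unfolding bimodule_map_def k_linear_def
proof (intro conjI ballI allI)
  fix z assume "z \<in> tensor2 right_X (ring_left unit_map)"
  then obtain f where z: "z = f +o XT_rel"
    unfolding tensor2_def by blast
  then show "transposition z \<in> tensor2 (ring_right unit_map) left_X"
    unfolding tensor2_def by (simp add: transposition_coset)
  show "transposition (z + z') = transposition z + transposition z'"
    if "z' \<in> tensor2 right_X (ring_left unit_map)" for z'
    using that unfolding tensor2_def
    by (auto simp: z coset_plus transposition_coset frag_extend_add)
  show "transposition (tensor2_scl right_X (ring_left unit_map) sX c z) =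
      tensor2_scl (ring_right unit_map) left_X sT c (transposition z)" for c
    unfolding tensor2_scl_def
    by (rule transposition_equivariant [OF z])
      (use twist_scl_T compatible_XT_endo [of "sX c" "\<lambda>t. t"]
          compatible_TX_endo [of "\<lambda>x. x" "sT c"] in
        \<open>simp_all add: X.V.scl_add_right X.act_scl_left V.scl_add_right T.scl_mult_left
          case_prod_unfold\<close>)
  show "transposition (tensor2_left right_X (ring_left unit_map) left_X r z) =
      tensor2_left (ring_right unit_map) left_X (ring_left unit_map) r (transposition z)" for r
    unfolding tensor2_left_def
    by (rule transposition_equivariant [OF z])
      (use twist_left compatible_XT_endo [of "left_X r" "\<lambda>t. t"]
          compatible_TX_endo [of "\<lambda>x. x" "ring_left unit_map r"] in
        \<open>simp_all add: X.act_add_left distrib_left mult.assoc bialg.ranges_commute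
          case_prod_unfold flip: X.act_mult\<close>)
  show "transposition (tensor2_right right_X (ring_left unit_map) (ring_right unit_map) z r) =
      tensor2_right (ring_right unit_map) left_X right_X (transposition z) r" for r
    unfolding tensor2_right_def
    by (rule transposition_equivariant [OF z])
      (use twist_right compatible_XT_endo [of "\<lambda>x. x" "\<lambda>t. ring_right unit_map t r"]
          compatible_TX_endo [of "\<lambda>x. right_X x r" "\<lambda>t. t"] in
        \<open>simp_all add: X.act_add_left distrib_right mult.assoc bialg.ranges_commute
          case_prod_unfold flip: X.act_mult\<close>)
qed

text \<open>Both sides are rewritten as cosets of explicit additive extensions, after which the
  identity is \<open>twist_mult\<close> on generators. The work lies in showing that the two partial
  transpositions are well defined.\<close>

lemma transposition_mult:
  assumes "z \<in> tensor3 right_X (ring_left unit_map) (ring_right unit_map) (ring_left unit_map)"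
  shows "transposition (quot_map XT_rel (\<lambda>(x, t, t'). (x, t * t')) z) =
    quot_map TX_rel (\<lambda>(t, t', x). (t * t', x))
     (quot_extend (tensor3_rel (ring_right unit_map) (ring_left unit_map) (ring_right unit_map) left_X)
        (\<lambda>(t, x, t').
           quot_map (tensor3_rel (ring_right unit_map) (ring_left unit_map) (ring_right unit_map) left_X)
             (\<lambda>(s, y). (t, s, y)) (transposition (frag_of (x, t') +o XT_rel)))
        (quot_extend (tensor3_rel (ring_right unit_map) left_X right_X (ring_left unit_map))
           (\<lambda>(x, t, t').
              quot_map (tensor3_rel (ring_right unit_map) left_X right_X (ring_left unit_map))
                (\<lambda>(s, y). (s, y, t')) (transposition (frag_of (x, t) +o XT_rel)))
           z))"
    (is "_ = quot_map _ _ (quot_extend ?TTX ?D2 (quot_extend ?TXT ?D1 z))")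
proof -
  let ?XTT = "tensor3_rel right_X (ring_left unit_map) (ring_right unit_map) (ring_left unit_map)"
  let ?m = "\<lambda>g. frag_of ((\<lambda>(x, t, t'). (x, t * t')) g) :: 'x \<times> 't \<Rightarrow>\<^sub>0 int"
  let ?m' = "\<lambda>g. frag_of ((\<lambda>(t, t', x). (t * t', x)) g) :: 't \<times> 'x \<Rightarrow>\<^sub>0 int"
  let ?i = "\<lambda>t' g. frag_of ((\<lambda>(s, y). (s, y, t')) g) :: 't \<times> 'x \<times> 't \<Rightarrow>\<^sub>0 int"
  let ?j = "\<lambda>t g. frag_of ((\<lambda>(s, y). (t, s, y)) g) :: 't \<times> 't \<times> 'x \<Rightarrow>\<^sub>0 int"
  \<comment> \<open>\<open>?e1\<close> transposes \<open>x\<close> with \<open>t\<close> and keeps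
    \<open>t'\<close> at the right; \<open>?e2\<close> transposes \<open>x\<close> with
    \<open>t'\<close> and keeps \<open>t\<close> at the left.\<close>
  let ?e1 = "\<lambda>(x, t, t'). frag_extend (?i t') (twist (x, t))"
  let ?e2 = "\<lambda>(t, x, t'). frag_extend (?j t) (twist (x, t'))"
  from assms obtain f where z: "z = f +o ?XTT"
    unfolding tensor3_def by blast
  have TXT_12: "frag_of (t * unit_map r, x, t') - frag_of (t, left_X r x, t') \<in> ?TXT" for t r x t'
    using tensor3_rel_balanced_12 [where rM = "ring_right unit_map"] .
  have TXT_23: "frag_of (t, right_X x r, t') - frag_of (t, x, unit_map r * t') \<in> ?TXT" for t r x t'
    using tensor3_rel_balanced_23 [where rP = right_X and lQ = "ring_left unit_map"] .
  have TTX_12: "frag_of (t * unit_map r, t', x) - frag_of (t, unit_map r * t', x) \<in> ?TTX" for t r x t'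
    using tensor3_rel_balanced_12 [where rM = "ring_right unit_map" and lP = "ring_left unit_map"] .
  have TTX_23: "frag_of (t, t' * unit_map r, x) - frag_of (t, t', left_X r x) \<in> ?TTX" for t r x t'
    using tensor3_rel_balanced_23 [where rP = "ring_right unit_map" and lQ = left_X] .
  have m: "compatible ?XTT ?m XT_rel"
    by (rule compatible_tensor3I)
      (simp_all add: distrib_left distrib_right mult.assoc tensor2_rel_intros XT_balanced
        add_subgroup_zero)
  have m': "compatible ?TTX ?m' TX_rel"
    by (rule compatible_tensor3I)
      (simp_all add: distrib_left distrib_right mult.assoc tensor2_rel_intros add_subgroup_zero
        TX_balanced [of "t * t'" for t t', unfolded mult.assoc])
  have i: "compatible TX_rel (?i t') ?TXT" for t'
    by (rule compatible_tensor2I) (simp_all add: tensor3_rel_intros TXT_12)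
  have j: "compatible TX_rel (?j t) ?TTX" for t
    by (rule compatible_tensor2I) (simp_all add: tensor3_rel_intros TTX_23)
  have e1: "compatible ?XTT ?e1 ?TXT"
  proof (rule compatible_tensor3I)
    fix x x' t s t' r
    show "?e1 (x + x', t, t') - ?e1 (x, t, t') - ?e1 (x', t, t') \<in> ?TXT"
      using compatibleD [OF i twist_add_left] by (simp add: frag_extend_diff)
    show "?e1 (x, t + s, t') - ?e1 (x, t, t') - ?e1 (x, s, t') \<in> ?TXT"
      using compatibleD [OF i twist_add_right] by (simp add: frag_extend_diff)
    show "?e1 (x, t, s + t') - ?e1 (x, t, s) - ?e1 (x, t, t') \<in> ?TXT"
      by simp (rule frag_extend_additive_mem; auto simp: tensor3_rel_add_1 tensor3_rel_add_3)
    show "?e1 (right_X x r, t, t') - ?e1 (x, unit_map r * t, t') \<in> ?TXT"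
      using compatibleD [OF i twist_balanced] by (simp add: frag_extend_diff)
    \<comment> \<open>\<open>twist_right\<close> puts \<open>r\<close> on the X-component, from
      which balancing passes it on to \<open>t'\<close>.\<close>
    have "?e1 (x, t * unit_map r, t') -
        frag_extend (\<lambda>(u, y). frag_of (u, right_X y r, t')) (twist (x, t)) \<in> ?TXT"
      using compatibleD [OF i twist_right]
      by (simp add: frag_extend_diff frag_extend_frag_extend case_prod_unfold)
    moreover have "frag_extend (\<lambda>(u, y). frag_of (u, right_X y r, t')) (twist (x, t)) -
        ?e1 (x, t, unit_map r * t') \<in> ?TXT"
      by simp (rule frag_extend_cong_mem; auto simp: TXT_23)
    ultimately show "?e1 (x, t * unit_map r, t') - ?e1 (x, t, unit_map r * t') \<in> ?TXT"
      by (rule add_subgroup_cong_trans [OF add_subgroup_tensor3_rel])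
  qed simp
  have e2: "compatible ?TXT ?e2 ?TTX"
  proof (rule compatible_tensor3I)
    fix x x' t s t' r
    show "?e2 (t + s, x, t') - ?e2 (t, x, t') - ?e2 (s, x, t') \<in> ?TTX"
      by simp (rule frag_extend_additive_mem; auto simp: tensor3_rel_add_1 tensor3_rel_add_3)
    show "?e2 (t, x + x', t') - ?e2 (t, x, t') - ?e2 (t, x', t') \<in> ?TTX"
      using compatibleD [OF j twist_add_left] by (simp add: frag_extend_diff)
    show "?e2 (t, x, s + t') - ?e2 (t, x, s) - ?e2 (t, x, t') \<in> ?TTX"
      using compatibleD [OF j twist_add_right] by (simp add: frag_extend_diff)
    show "?e2 (t, right_X x r, t') - ?e2 (t, x, unit_map r * t') \<in> ?TTX"
      using compatibleD [OF j twist_balanced] by (simp add: frag_extend_diff)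
    \<comment> \<open>Both terms meet at \<open>unit_map r\<close> in front of the new T-component:
      the first by balancing, the second by \<open>twist_left\<close>.\<close>
    have "?e2 (t * unit_map r, x, t') -
        frag_extend (\<lambda>(u, y). frag_of (t, unit_map r * u, y)) (twist (x, t')) \<in> ?TTX"
      by simp (rule frag_extend_cong_mem; auto simp: TTX_12)
    moreover have "?e2 (t, left_X r x, t') -
        frag_extend (\<lambda>(u, y). frag_of (t, unit_map r * u, y)) (twist (x, t')) \<in> ?TTX"
      using compatibleD [OF j twist_left]
      by (simp add: frag_extend_diff frag_extend_frag_extend case_prod_unfold)
    ultimately show "?e2 (t * unit_map r, x, t') - ?e2 (t, left_X r x, t') \<in> ?TTX"
      by (rule add_subgroup_cong_common [OF add_subgroup_tensor3_rel])
  qed simp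
  have D1: "?D1 g = ?e1 g +o ?TXT" for g
    by (cases g)
      (simp only: prod.case transposition_coset frag_extend_of
        quot_map_coset [OF add_subgroup_tensor3_rel add_subgroup_tensor2_rel i])
  have D2: "?D2 g = ?e2 g +o ?TTX" for g
    by (cases g)
      (simp only: prod.case transposition_coset frag_extend_of
        quot_map_coset [OF add_subgroup_tensor3_rel add_subgroup_tensor2_rel j])
  have "frag_extend twist (frag_extend ?m f) -
      frag_extend ?m' (frag_extend ?e2 (frag_extend ?e1 f)) \<in> TX_rel"
    unfolding frag_extend_frag_extend
    by (rule frag_extend_cong_mem)
      (use twist_mult in \<open>auto simp: frag_extend_frag_extend case_prod_unfold\<close>)
  then show ?thesis
    unfolding z quot_map_coset [OF add_subgroup_tensor2_rel add_subgroup_tensor3_rel m]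
      quot_extend_coset [OF add_subgroup_tensor3_rel add_subgroup_tensor3_rel e1 D1]
      quot_extend_coset [OF add_subgroup_tensor3_rel add_subgroup_tensor3_rel e2 D2]
      quot_map_coset [OF add_subgroup_tensor2_rel add_subgroup_tensor3_rel m']
    unfolding transposition_coset coset_eq_iff [OF add_subgroup_tensor2_rel] .
qed

lemma transposition_map: "transposition_map sR sT unit_map sX left_X right_X transposition"
proof (intro transposition_map.intro transposition_map_axioms.intro)
  show "transposition (frag_of (x, unit_map 1) +o XT_rel) = frag_of (unit_map 1, x) +o TX_rel" for x
  proof -
    have "unit_map 1 = 1"
      by (simp add: unit_map_def act_one)
    then show ?thesis
      by (simp add: transposition_coset coset_eq_iff twist_one)
  qed
qed (simp_all only: unit_map_hom transposition_bimodule_map transposition_mult bimodule_X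
    bialg.R.k_algebra_axioms T.k_algebra_axioms)


subsection \<open>The para-cocyclic structure\<close>

sublocale C: ring_chain sR sX left_X right_X unit_map
  using bimodule_X by (rule ring_chain.intro)

definition rotate :: "'t list \<times> 'x \<Rightarrow> ('t list \<times> 'x \<Rightarrow>\<^sub>0 int)" where
  "rotate = (\<lambda>(ts, x). frag_extend (\<lambda>(u, y). frag_of (tl ts @ [u], y)) (twist (x, hd ts)))"

lemma rotate_Cons: "rotate (t # ts, x) = frag_extend (\<lambda>(u, y). frag_of (ts @ [u], y)) (twist (x, t))"
  by (simp add: rotate_def)

text \<open>Prefixing a fixed word carries congruences in the tensor product of T and X to
  congruences of cyclic words, so the laws of \<open>twist\<close> become usable for
  \<open>rotate\<close>.\<close>

lemma compatible_snoc:
  "length ts = n \<Longrightarrow> compatible TX_rel (\<lambda>(u, y). frag_of (ts @ [u], y)) (C.relations n)"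
  by (rule compatible_tensor2I)
    (simp_all add: C.rel_add C.rel_add_X C.rel_balanced_X)

text \<open>Relators that avoid both the first letter and \<open>x\<close> just move along; the
  others rest on the laws of \<open>twist\<close>. The cyclic relations enter because an element of
  R next to the departing first letter must reach the new first letter through X.\<close>

lemma chain_hom_rotate: "C.chain_hom n n rotate"
  unfolding C.chain_hom_def
proof (intro conjI compatible_cyc_relI allI impI)
  show "rotate (us @ (a + b) # vs, x) - rotate (us @ a # vs, x) - rotate (us @ b # vs, x)
      \<in> C.relations n"
    if "length us + length vs = n" for us a b vs x
  proof (cases us)
    case Nil
    with that compatibleD [OF compatible_snoc [of vs n] twist_add_right] show ?thesis
      by (simp add: rotate_Cons frag_extend_diff)
  next
    case (Cons u us')
    then show ?thesis
      by (simp add: rotate_Cons)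
        (rule frag_extend_additive_mem; use that Cons in \<open>auto intro!: C.rel_add\<close>)
  qed
  show "rotate (ts, x + y) - rotate (ts, x) - rotate (ts, y) \<in> C.relations n"
    if "length ts = Suc n" for ts x y
  proof -
    from that obtain t ts' where "ts = t # ts'" "length ts' = n" by (cases ts) auto
    with compatibleD [OF compatible_snoc [of ts' n] twist_add_left] show ?thesis
      by (simp add: rotate_Cons frag_extend_diff)
  qed
  show "rotate (us @ (a * unit_map r) # b # vs, x) - rotate (us @ a # (unit_map r * b) # vs, x)
      \<in> C.relations n"
    if "Suc (length us + length vs) = n" for us a r b vs x
  proof (cases us)
    \<comment> \<open>Here \<open>r\<close> sits between the first two letters:
      \<open>twist_right\<close> moves it to X, and the cyclic relation carries it to
      \<open>b\<close>, the new first letter.\<close>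
    case Nil
    with that have n: "length (b # vs) = n" by simp
    have "rotate ((a * unit_map r) # b # vs, x) -
        frag_extend (\<lambda>(u, y). frag_of (b # vs @ [u], right_X y r)) (twist (x, a)) \<in> C.relations n"
      using compatibleD [OF compatible_snoc [OF n] twist_right]
      by (simp add: rotate_Cons frag_extend_diff frag_extend_frag_extend case_prod_unfold)
    moreover have "rotate (a # (unit_map r * b) # vs, x) -
        frag_extend (\<lambda>(u, y). frag_of (b # vs @ [u], right_X y r)) (twist (x, a)) \<in> C.relations n"
      unfolding rotate_Cons
      by (rule frag_extend_cong_mem) (use n in \<open>auto intro!: C.rel_cyclic\<close>)
    ultimately show ?thesis
      unfolding Nil append_Nil by (rule add_subgroup_cong_common [OF add_subgroup_cyc_rel])
  next
    case (Cons u us')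
    then show ?thesis
      by (simp add: rotate_Cons)
        (rule frag_extend_cong_mem; use that Cons in \<open>auto intro!: C.rel_balanced\<close>)
  qed
  show "rotate (us @ [a * unit_map r], x) - rotate (us @ [a], left_X r x) \<in> C.relations n"
    if n: "length us = n" for us a r x
  proof (cases us)
    \<comment> \<open>For \<open>n = 0\<close> the only letter is both first and last:
      \<open>r\<close> goes to X by \<open>twist_right\<close> and round the cycle to the front of
      the new letter, where \<open>twist_left\<close> recovers it.\<close>
    case Nil
    have "rotate ([a * unit_map r], x) -
        frag_extend (\<lambda>(u, y). frag_of ([u], right_X y r)) (twist (x, a)) \<in> C.relations n"
      using compatibleD [OF compatible_snoc twist_right, of "[]" n] Nil n
      by (simp add: rotate_Cons frag_extend_diff frag_extend_frag_extend case_prod_unfold)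
    moreover have "frag_extend (\<lambda>(u, y). frag_of ([unit_map r * u], y)) (twist (x, a)) -
        frag_extend (\<lambda>(u, y). frag_of ([u], right_X y r)) (twist (x, a)) \<in> C.relations n"
      by (rule frag_extend_cong_mem) (use Nil n in \<open>auto intro!: C.rel_cyclic\<close>)
    ultimately have "rotate ([a * unit_map r], x) -
        frag_extend (\<lambda>(u, y). frag_of ([unit_map r * u], y)) (twist (x, a)) \<in> C.relations n"
      by (rule add_subgroup_cong_common [OF add_subgroup_cyc_rel])
    moreover have "rotate ([a], left_X r x) -
        frag_extend (\<lambda>(u, y). frag_of ([unit_map r * u], y)) (twist (x, a)) \<in> C.relations n"
      using compatibleD [OF compatible_snoc twist_left, of "[]" n] Nil n
      by (simp add: rotate_Cons frag_extend_diff frag_extend_frag_extend case_prod_unfold)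
    ultimately show ?thesis
      unfolding Nil append_Nil by (rule add_subgroup_cong_common [OF add_subgroup_cyc_rel])
  next
    case (Cons v us')
    have "rotate (us @ [a * unit_map r], x) -
        frag_extend (\<lambda>(u, y). frag_of (us' @ [a] @ [unit_map r * u], y)) (twist (x, v)) \<in> C.relations n"
      unfolding Cons append_Cons rotate_Cons
      by (rule frag_extend_cong_mem)
        (use n Cons C.rel_balanced [of us' "[]" n a r] in \<open>auto\<close>)
    moreover have "rotate (us @ [a], left_X r x) -
        frag_extend (\<lambda>(u, y). frag_of (us' @ [a] @ [unit_map r * u], y)) (twist (x, v)) \<in> C.relations n"
      using compatibleD [OF compatible_snoc twist_left, of "us' @ [a]" n] Cons n
      by (simp add: rotate_Cons frag_extend_diff frag_extend_frag_extend case_prod_unfold)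
    ultimately show ?thesis
      by (rule add_subgroup_cong_common [OF add_subgroup_cyc_rel])
  qed
  show "rotate ((unit_map r * t) # ts, x) - rotate (t # ts, right_X x r) \<in> C.relations n"
    if "length ts = n" for r t ts x
    using compatibleD [OF compatible_snoc [OF that] twist_balanced [of x r t]]
    by - (rule add_subgroup_cong_sym [OF add_subgroup_cyc_rel];
      simp add: rotate_Cons frag_extend_diff)
  show "rotate (ts, x) \<in> chain_free n" if "length ts = Suc n" for ts x
    unfolding rotate_def prod.case
    by (rule frag_extend_mem) (use that in auto)
qed simp

definition cyclic_shift :: "nat \<Rightarrow> ('t list \<times> 'x \<Rightarrow>\<^sub>0 int) set \<Rightarrow> ('t list \<times> 'x \<Rightarrow>\<^sub>0 int) set" where
  "cyclic_shift n = coset_map (C.relations n) rotate"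

lemma cyclic_shift_generator:
  assumes n: "length ts = n" and f: "f \<in> \<rho> t"
  shows "cyclic_shift n (frag_of (t # ts, x) +o C.relations n) =
    frag_extend (\<lambda>(t', b). frag_of (ts @ [t'], act x b)) f +o C.relations n"
  using compatibleD [OF compatible_snoc [OF n] twist_coaction [OF f, of x]]
  by (simp add: cyclic_shift_def C.chain_hom_coset [OF chain_hom_rotate] rotate_Cons coset_eq_iff
      frag_extend_diff frag_extend_frag_extend case_prod_unfold)

text \<open>A coface or codegeneracy at a position \<open>k \<ge> 1\<close> leaves the first letter
  alone, so it commutes with the rotation on the nose; \<open>G\<close> is the same operation at
  position \<open>k - 1\<close>.\<close>

lemma frag_extend_on_list_rotate:
  assumes "length ts = Suc n"
    and "\<And>u. tl (F ts) @ [u] = G (tl ts @ [u])" and "hd (F ts) = hd ts"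
  shows "rotate (F ts, x) = frag_extend (C.on_list G) (rotate (ts, x))"
  using assms by (simp add: rotate_def frag_extend_frag_extend case_prod_unfold)

lemma para_cocyclic:
  "para_cocyclic_module C.chains C.relations C.scalar C.coface C.codegen cyclic_shift"
proof (intro para_cocyclic_module.intro para_cocyclic_module_axioms.intro C.cosimplicial_chains)
  show "k_linear (C.chains n) (C.scalar n) (C.chains n) (C.scalar n) (cyclic_shift n)" for n
    unfolding cyclic_shift_def
    by (rule C.k_linear_coset_map [OF chain_hom_rotate])
      (simp add: rotate_def twist_scl_X frag_extend_frag_extend case_prod_unfold add_subgroup_zero)
  show "cyclic_shift n (C.coface n 0 z) = C.coface n n z" if "1 \<le> n" "z \<in> C.chains (n - 1)" for n z
  proof -
    from that obtain n' where n: "n = Suc n'" and z: "z \<in> C.chains n'" by (cases n) auto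
    have hom: "C.chain_hom n' n (C.on_list (insert_one k))" if "k \<le> n" for k
      using C.chain_hom_insert_one that by (simp add: n)
    \<comment> \<open>The coface puts a unit in front; by \<open>twist_one\<close> the rotation
      moves it to the end and leaves \<open>x\<close> unchanged.\<close>
    have "rotate (insert_one 0 ts, x) - C.on_list (insert_one n) (ts, x) \<in> C.relations n"
      if "length ts = n" for ts x
      using compatibleD [OF compatible_snoc [OF that] twist_one [of x]] that
      by (simp add: rotate_Cons frag_extend_diff insert_one_def)
    then show ?thesis
      unfolding cyclic_shift_def C.coface_eq C.coset_map_comp [OF z hom [OF le0] chain_hom_rotate]
      by (intro C.chain_hom_eqI [OF z C.chain_hom_comp [OF hom chain_hom_rotate] hom])
        (simp_all add: n)
  qed
  show "cyclic_shift n (C.coface n k z) = C.coface n (k - 1) (cyclic_shift (n - 1) z)"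
    if "1 \<le> k" "k \<le> n" "z \<in> C.chains (n - 1)" for k n z
  proof -
    from that obtain n' k' where n: "n = Suc n'" "k = Suc k'" by (cases n; cases k) auto
    show ?thesis
      unfolding cyclic_shift_def C.coface_eq
    proof (rule C.comp_eqI [OF that(3)])
      show "frag_extend rotate (C.on_list (insert_one k) (ts, x)) -
          frag_extend (C.on_list (insert_one (k - 1))) (rotate (ts, x)) \<in> C.relations n"
        if "length ts = Suc (n - 1)" for ts x
      proof -
        from that obtain t ts' where ts: "ts = t # ts'" "length ts' = n'" by (cases ts) (auto simp: n)
        have "rotate (insert_one k ts, x) = frag_extend (C.on_list (insert_one (k - 1))) (rotate (ts, x))"
          by (rule frag_extend_on_list_rotate)
            (use \<open>k \<le> n\<close> ts in \<open>simp_all add: n insert_one_append\<close>)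
        then show ?thesis by (simp add: add_subgroup_zero)
      qed
    qed (use that chain_hom_rotate C.chain_hom_insert_one in \<open>simp_all add: n\<close>)
  qed
  show "cyclic_shift n (C.codegen n 0 z) =
      C.codegen n n (cyclic_shift (n + 1) (cyclic_shift (n + 1) z))"
    if z: "z \<in> C.chains (n + 1)" for n z
  proof -
    have hom: "C.chain_hom (n + 1) n (C.on_list (merge_at k))" if "k \<le> n" for k
      using C.chain_hom_merge_at that by simp
    note rotate2 = C.chain_hom_comp [OF chain_hom_rotate chain_hom_rotate]
    show ?thesis
      unfolding cyclic_shift_def C.codegen_eq C.coset_map_comp [OF z chain_hom_rotate chain_hom_rotate]
    proof (rule C.comp_eqI [OF z hom chain_hom_rotate rotate2 hom])
      fix ts :: "'t list" and x
      assume "length ts = Suc (n + 1)"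
      then obtain t t' us where ts: "ts = t # t' # us" "length us = n"
        by (cases ts; cases "tl ts") auto
      \<comment> \<open>Two rotations put the T-components of \<open>t\<close> and \<open>t'\<close>
        at positions \<open>n\<close> and \<open>n + 1\<close>, where the last codegeneracy
        multiplies them; \<open>twist_mult\<close> identifies the result with rotating
        \<open>t * t'\<close>.\<close>
      have merge: "merge_at n (us @ [u, u']) = us @ [u * u']" for u u'
        using ts by (simp add: merge_at_append_right)
      show "frag_extend rotate (C.on_list (merge_at 0) (ts, x)) -
          frag_extend (C.on_list (merge_at n)) (frag_extend rotate (rotate (ts, x))) \<in> C.relations n"
        using compatibleD [OF compatible_snoc [OF ts(2)] twist_mult [of x t t']]
        by (simp add: ts(1) rotate_Cons frag_extend_diff frag_extend_frag_extend case_prod_unfold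
            merge)
    qed simp_all
  qed
  show "cyclic_shift n (C.codegen n k z) = C.codegen n (k - 1) (cyclic_shift (n + 1) z)"
    if "1 \<le> k" "k \<le> n" "z \<in> C.chains (n + 1)" for k n z
  proof -
    from that obtain n' k' where n: "n = Suc n'" "k = Suc k'" by (cases n; cases k) auto
    show ?thesis
      unfolding cyclic_shift_def C.codegen_eq
    proof (rule C.comp_eqI [OF that(3)])
      show "frag_extend rotate (C.on_list (merge_at k) (ts, x)) -
          frag_extend (C.on_list (merge_at (k - 1))) (rotate (ts, x)) \<in> C.relations n"
        if "length ts = Suc (n + 1)" for ts x
      proof -
        from that obtain t ts' where ts: "ts = t # ts'" "length ts' = Suc n" by (cases ts) auto
        have "rotate (merge_at k ts, x) = frag_extend (C.on_list (merge_at (k - 1))) (rotate (ts, x))"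
          by (rule frag_extend_on_list_rotate)
            (use \<open>k \<le> n\<close> ts in \<open>simp_all add: n merge_at_append_left\<close>)
        then show ?thesis by (simp add: add_subgroup_zero)
      qed
    qed (use that chain_hom_rotate C.chain_hom_merge_at in \<open>simp_all add: n\<close>)
  qed
qed

end

text \<open>Quantifying over all \<open>f\<close> in the coaction renders the Sweedler formulas:
  they hold for every representative. The conjuncts before the transposition map justify using
  \<open>ring_left\<close> and \<open>ring_right\<close> for the actions on T.\<close>

theorem theorem2p7:
  fixes sR :: "'k::{comm_ring,comm_monoid_mult} \<Rightarrow> 'r::{ring,monoid_mult} \<Rightarrow> 'r"
    and sB :: "'k \<Rightarrow> 'b::{ring,monoid_mult} \<Rightarrow> 'b"
    and \<xi> \<zeta> :: "'r \<Rightarrow> 'b"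
    and \<Delta> :: "'b \<Rightarrow> ('b \<times> 'b \<Rightarrow>\<^sub>0 int) set"
    and \<epsilon> :: "'b \<Rightarrow> 'r"
    and sT :: "'k \<Rightarrow> 't::{ring,monoid_mult} \<Rightarrow> 't"
    and rT :: "'t \<Rightarrow> 'r \<Rightarrow> 't"
    and \<rho> :: "'t \<Rightarrow> ('t \<times> 'b \<Rightarrow>\<^sub>0 int) set"
    and sX :: "'k \<Rightarrow> 'x::ab_group_add \<Rightarrow> 'x"
    and act :: "'x \<Rightarrow> 'b \<Rightarrow> 'x"
    and lT :: "'r \<Rightarrow> 't \<Rightarrow> 't"
    and \<phi> :: "'r \<Rightarrow> 't"
    and lX :: "'r \<Rightarrow> 'x \<Rightarrow> 'x"
    and rX :: "'x \<Rightarrow> 'r \<Rightarrow> 'x"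
  assumes "right_bialgebroid sR sB \<xi> \<zeta> \<Delta> \<epsilon>"
    and "right_comodule_algebra sR sB \<xi> \<zeta> \<Delta> \<epsilon> sT rT \<rho>"
    and "right_module sB sX act"
    and lT: "lT = comodule_left \<xi> \<epsilon> rT \<rho>"
    and \<phi>: "\<phi> = (\<lambda>r. lT r 1)"
    and lX: "lX = (\<lambda>r x. act x (\<zeta> r))"
    and rX: "rX = (\<lambda>x r. act x (\<xi> r))"
  shows "(\<forall>r. \<phi> r = rT 1 r) \<and>
    (\<forall>r t. lT r t = \<phi> r * t \<and> rT t r = t * \<phi> r) \<and>
    (\<exists>w. transposition_map sR sT \<phi> sX lX rX w \<and>
      (\<forall>x t. \<forall>f\<in>\<rho> t.
        w (frag_of (x, t) +o tensor2_rel rX (ring_left \<phi>)) =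
        frag_extend (\<lambda>(t', b). frag_of (t', act x b)) f +o tensor2_rel (ring_right \<phi>) lX)) \<and>
    (\<exists>w. para_cocyclic_module
        (cyc_tensor lT rT lX rX) (cyc_rel lT rT lX rX) (cyc_scl lT rT lX rX sX)
        (cyc_coface lT rT lX rX) (cyc_codegen lT rT lX rX) w \<and>
      (\<forall>n t\<^sub>0 ts x. length ts = n \<longrightarrow> (\<forall>f\<in>\<rho> t\<^sub>0.
        w n (frag_of (t\<^sub>0 # ts, x) +o cyc_rel lT rT lX rX n) =
        frag_extend (\<lambda>(t', b). frag_of (ts @ [t'], act x b)) f +o cyc_rel lT rT lX rX n)))"
proof -
  interpret comodule_algebra_module sR sB \<xi> \<zeta> \<Delta> \<epsilon> sT rT \<rho> sX act
    using assms(2,3) by (rule comodule_algebra_module.intro)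
  \<comment> \<open>The given actions on T are those induced by \<open>unit_map\<close>, so the
    tensor products of the statement are the ones treated above.\<close>
  have lT': "lT = ring_left unit_map"
    by (simp add: fun_eq_iff lT comodule_left_eq)
  have rT': "rT = ring_right unit_map"
    by (simp add: fun_eq_iff rT_eq)
  have \<phi>': "\<phi> = unit_map"
    by (simp add: fun_eq_iff \<phi> lT')
  have "transposition (frag_of (x, t) +o XT_rel) =
      frag_extend (\<lambda>(t', b). frag_of (t', act x b)) f +o TX_rel" if "f \<in> \<rho> t" for x t f
    by (simp add: transposition_coset coset_eq_iff twist_coaction that)
  then show ?thesis
    unfolding \<phi>' lX rX lT'
  proof (intro conjI allI exI [of _ transposition] exI [of _ cyclic_shift])
    show "unit_map r = rT 1 r" for r
      by (rule unit_map_def)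
    show "rT t r = t * unit_map r" for t r
      by (rule rT_eq)
  qed (use transposition_map para_cocyclic cyclic_shift_generator in \<open>auto simp flip: rT'\<close>)
qed

end
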